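(* Let $(R,\mathfrak m,k)\to(S,\mathfrak n,\ell)$ be a local homomorphism of commutative Noetherian local rings, and let $M$ be an Artinian $S$-module. Then $M$ is injective over $R$ (via restriction of scalars) if and only if $\operatorname{Ext}^1_R(k,M)=0$.
   Context: $(R,\mathfrak m,k)$ denotes a local ring $R$ with maximal ideal $\mathfrak m$ and residue field $k=R/\mathfrak m$; similarly for $(S,\mathfrak n,\ell)$. *)

theory Defs
  imports
    "HOL-Algebra.Module"
    "HOL-Algebra.QuotRing"
    "HOL-Algebra.Ring_Divisibility"
begin

section \<open>Local rings and local homomorphisms\<close>

definition local_ring :: "('r, 'x) ring_scheme \<Rightarrow> 'r set \<Rightarrow> bool" where
  "local_ring R \<mm> \<longleftrightarrow>
     cring R \<and> maximalideal \<mm> R \<and> (\<forall>I. maximalideal I R \<longrightarrow> I = \<mm>)"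

definition noetherian_local_ring :: "('r, 'x) ring_scheme \<Rightarrow> 'r set \<Rightarrow> bool" where
  "noetherian_local_ring R \<mm> \<longleftrightarrow> local_ring R \<mm> \<and> noetherian_ring R"

definition local_hom ::
  "('r, 'x) ring_scheme \<Rightarrow> 'r set \<Rightarrow> ('s, 'y) ring_scheme \<Rightarrow> 's set \<Rightarrow> ('r \<Rightarrow> 's) \<Rightarrow> bool" where
  "local_hom R \<mm> S \<nn> \<phi> \<longleftrightarrow> \<phi> \<in> ring_hom R S \<and> \<phi> ` \<mm> \<subseteq> \<nn>"


section \<open>Modules and linear maps\<close>

text \<open>
  The record \<^type>\<open>module\<close> extends \<^type>\<open>ring\<close>, but the locale \<^locale>\<open>module\<close> puts no condition
  on the fields \<open>mult\<close> and \<open>one\<close>; for the modules built here they are set to \<^const>\<open>undefined\<close>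
  whenever there is no natural choice.
\<close>

definition linear_map ::
  "('r, 'x) ring_scheme \<Rightarrow> ('r, 'a, 'y) module_scheme \<Rightarrow> ('r, 'b, 'z) module_scheme \<Rightarrow> ('a \<Rightarrow> 'b) \<Rightarrow> bool" where
  "linear_map R A B f \<longleftrightarrow>
     f \<in> carrier A \<rightarrow> carrier B \<and>
     (\<forall>x\<in>carrier A. \<forall>y\<in>carrier A. f (x \<oplus>\<^bsub>A\<^esub> y) = f x \<oplus>\<^bsub>B\<^esub> f y) \<and>
     (\<forall>r\<in>carrier R. \<forall>x\<in>carrier A. f (r \<odot>\<^bsub>A\<^esub> x) = r \<odot>\<^bsub>B\<^esub> f x)"

definition regular_module :: "('r, 'x) ring_scheme \<Rightarrow> ('r, 'r) module" where
  "regular_module R =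
     \<lparr>carrier = carrier R, mult = mult R, one = one R, zero = zero R, add = add R, smult = mult R\<rparr>"

definition restrict_scalars ::
  "('r \<Rightarrow> 's) \<Rightarrow> ('s, 'm, 'y) module_scheme \<Rightarrow> ('r, 'm) module" where
  "restrict_scalars \<phi> M =
     \<lparr>carrier = carrier M, mult = mult M, one = one M, zero = zero M, add = add M,
      smult = (\<lambda>r x. \<phi> r \<odot>\<^bsub>M\<^esub> x)\<rparr>"

text \<open>The residue field \<open>R / \<mm>\<close>, viewed as an \<open>R\<close>-module along the quotient map.\<close>

definition residue_module :: "('r, 'x) ring_scheme \<Rightarrow> 'r set \<Rightarrow> ('r, 'r set) module" where
  "residue_module R \<mm> = restrict_scalars (\<lambda>r. \<mm> +>\<^bsub>R\<^esub> r) (regular_module (R Quot \<mm>))"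

definition artinian_module :: "('s, 'y) ring_scheme \<Rightarrow> ('s, 'm, 'z) module_scheme \<Rightarrow> bool" where
  "artinian_module S M \<longleftrightarrow>
     module S M \<and>
     (\<forall>N :: nat \<Rightarrow> 'm set.
        (\<forall>i. submodule (N i) S M) \<and> (\<forall>i. N (Suc i) \<subseteq> N i) \<longrightarrow>
        (\<exists>n. \<forall>i\<ge>n. N i = N n))"

text \<open>
  Injectivity is the extension property along all injective linear maps \<open>A \<rightarrow> B\<close>.  A HOL predicate
  can only quantify over modules whose elements belong to one given type, so this type is made a
  parameter.  When it is instantiated with \<open>'r + 'u\<close> for an arbitrary type \<open>'u\<close>, it contains copies
  of the ring, of its ideals and of all modules over \<open>'u\<close>.
\<close>

definition injective_module ::
  "'u itself \<Rightarrow> ('r, 'x) ring_scheme \<Rightarrow> ('r, 'm, 'y) module_scheme \<Rightarrow> bool" where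
  "injective_module (_ :: 'u itself) R M \<longleftrightarrow>
     module R M \<and>
     (\<forall>(A :: ('r, 'u) module) (B :: ('r, 'u) module) i f.
        module R A \<and> module R B \<and>
        linear_map R A B i \<and> inj_on i (carrier A) \<and> linear_map R A M f \<longrightarrow>
        (\<exists>g. linear_map R B M g \<and> (\<forall>x\<in>carrier A. g (i x) = f x)))"

definition quotient_module ::
  "('r, 'm, 'y) module_scheme \<Rightarrow> 'm set \<Rightarrow> ('r, 'm set) module" where
  "quotient_module M N =
     \<lparr>carrier = a_rcosets\<^bsub>M\<^esub> N, mult = undefined, one = undefined, zero = N, add = set_add M,
      smult = (\<lambda>r X. \<Union>x\<in>X. N +>\<^bsub>M\<^esub> (r \<odot>\<^bsub>M\<^esub> x))\<rparr>"

text \<open>The elements of \<open>Hom\<^sub>R(A, B)\<close> are made extensional, so that equality is equality on \<open>A\<close>.\<close>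

definition Hom_module ::
  "('r, 'x) ring_scheme \<Rightarrow> ('r, 'a, 'y) module_scheme \<Rightarrow> ('r, 'b, 'z) module_scheme \<Rightarrow> ('r, 'a \<Rightarrow> 'b) module" where
  "Hom_module R A B =
     \<lparr>carrier = {f \<in> extensional (carrier A). linear_map R A B f},
      mult = undefined, one = undefined,
      zero = (\<lambda>x\<in>carrier A. \<zero>\<^bsub>B\<^esub>),
      add = (\<lambda>f g. \<lambda>x\<in>carrier A. f x \<oplus>\<^bsub>B\<^esub> g x),
      smult = (\<lambda>r f. \<lambda>x\<in>carrier A. r \<odot>\<^bsub>B\<^esub> f x)\<rparr>"

definition Hom_map :: "('r, 'a, 'y) module_scheme \<Rightarrow> ('a \<Rightarrow> 'b) \<Rightarrow> ('b \<Rightarrow> 'c) \<Rightarrow> 'a \<Rightarrow> 'c" where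
  "Hom_map A d f = (\<lambda>x\<in>carrier A. f (d x))"


section \<open>Free resolutions and Ext\<close>

text \<open>The free module on a set \<open>X\<close>: finitely supported functions from \<open>X\<close> to \<open>R\<close>.\<close>

definition free_module :: "('r, 'x) ring_scheme \<Rightarrow> 'a set \<Rightarrow> ('r, 'a \<Rightarrow> 'r) module" where
  "free_module R X =
     \<lparr>carrier = {f. (\<forall>x\<in>X. f x \<in> carrier R) \<and> (\<forall>x. x \<notin> X \<longrightarrow> f x = \<zero>\<^bsub>R\<^esub>) \<and> finite {x. f x \<noteq> \<zero>\<^bsub>R\<^esub>}},
      mult = undefined, one = undefined,
      zero = (\<lambda>x. \<zero>\<^bsub>R\<^esub>),
      add = (\<lambda>f g x. f x \<oplus>\<^bsub>R\<^esub> g x),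
      smult = (\<lambda>r f x. r \<otimes>\<^bsub>R\<^esub> f x)\<rparr>"

text \<open>
  Every module \<open>N\<close> is covered by the free module on its underlying set; the syzygy module is the
  kernel of this cover.
\<close>

definition free_cover ::
  "('r, 'x) ring_scheme \<Rightarrow> ('r, 'n, 'y) module_scheme \<Rightarrow> ('r, 'n \<Rightarrow> 'r) module" where
  "free_cover R N = free_module R (carrier N)"

definition cover_map ::
  "('r, 'x) ring_scheme \<Rightarrow> ('r, 'n, 'y) module_scheme \<Rightarrow> ('n \<Rightarrow> 'r) \<Rightarrow> 'n" where
  "cover_map R N f = (\<Oplus>\<^bsub>N\<^esub>x\<in>{x \<in> carrier N. f x \<noteq> \<zero>\<^bsub>R\<^esub>}. f x \<odot>\<^bsub>N\<^esub> x)"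

definition syzygy ::
  "('r, 'x) ring_scheme \<Rightarrow> ('r, 'n, 'y) module_scheme \<Rightarrow> ('r, 'n \<Rightarrow> 'r) module" where
  "syzygy R N = (free_cover R N)\<lparr>carrier := a_kernel (free_cover R N) N (cover_map R N)\<rparr>"

text \<open>The homology of \<open>A \<rightarrow> B \<rightarrow> C\<close> (maps \<open>f\<close> and \<open>g\<close>) at \<open>B\<close>.\<close>

definition homology_module ::
  "('r, 'a, 'x) module_scheme \<Rightarrow> ('a \<Rightarrow> 'b) \<Rightarrow> ('r, 'b) module \<Rightarrow>
   ('b \<Rightarrow> 'c) \<Rightarrow> ('r, 'c, 'y) module_scheme \<Rightarrow> ('r, 'b set) module" where
  "homology_module A f B g C = quotient_module (B\<lparr>carrier := a_kernel B C g\<rparr>) (f ` carrier A)"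

text \<open>
  \<open>Ext\<^sup>1\<^sub>R(N, M)\<close> is the first cohomology of \<open>Hom\<^sub>R(P, M)\<close> for a free resolution \<open>P\<close> of \<open>N\<close>.  We take
  the resolution obtained by repeatedly covering syzygies, of which only
  \<open>P\<^sub>2 \<rightarrow> P\<^sub>1 \<rightarrow> P\<^sub>0 \<rightarrow> N \<rightarrow> 0\<close> is needed.  Since the syzygy of \<open>N\<close> is a submodule of \<open>P\<^sub>0\<close>, its cover
  map serves as the differential \<open>P\<^sub>1 \<rightarrow> P\<^sub>0\<close>, and likewise for \<open>P\<^sub>2 \<rightarrow> P\<^sub>1\<close>.
\<close>

definition Ext1 ::
  "('r, 'x) ring_scheme \<Rightarrow> ('r, 'n, 'y) module_scheme \<Rightarrow> ('r, 'm, 'z) module_scheme \<Rightarrow>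
   ('r, ((('n \<Rightarrow> 'r) \<Rightarrow> 'r) \<Rightarrow> 'm) set) module" where
  "Ext1 R N M =
    (let P0 = free_cover R N;
         K0 = syzygy R N;
         P1 = free_cover R K0;
         d1 = cover_map R K0;
         K1 = syzygy R K0;
         P2 = free_cover R K1;
         d2 = cover_map R K1
     in homology_module
          (Hom_module R P0 M) (Hom_map P1 d1)
          (Hom_module R P1 M) (Hom_map P2 d2)
          (Hom_module R P2 M))"

definition zero_module :: "('r, 'm, 'y) module_scheme \<Rightarrow> bool" where
  "zero_module M \<longleftrightarrow> carrier M = {\<zero>\<^bsub>M\<^esub>}"

end

theory Submission
  imports Defs
begin

text \<open>
  Write \<open>k = R / \<mm>\<close>.  The vanishing of \<open>Ext\<^sup>1(k, M)\<close> says that every linear map from the single ideal \<open>\<mm>\<close> to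
  \<open>M\<close> extends to \<open>R\<close> (\<open>zero_Ext1_iff\<close>, \<open>residue_Ext1_zero_extends\<close>), while by Baer's criterion
  (\<open>injective_iff_baer\<close>) injectivity says the same for all ideals.  So injectivity implies the vanishing,
  and the task is to pass from \<open>\<mm>\<close> to an arbitrary ideal.

  What makes this possible is that each element of \<open>M\<close> is killed by a power of each \<open>a \<in> \<mm>\<close>
  (\<open>artinian_torsion\<close>).  Indeed, \<open>a\<close> acts as an element \<open>s\<close> of \<open>\<nn>\<close>, because the homomorphism is local; for
  \<open>x \<in> M\<close> the descending chain of submodules \<open>s\<^sup>i S x\<close> becomes stationary, and Nakayama's argument for cyclic
  modules gives \<open>s\<^sup>n x = 0\<close>.

  Now let a linear map from an ideal of \<open>R\<close> to \<open>M\<close> be given and extend it as far as possible within \<open>R\<close>, to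
  an ideal \<open>I\<close>.  Torsion and the ascending chain condition show that the map could be extended by zero to a large
  power of any \<open>a \<in> \<mm>\<close>, so \<open>I\<close> contains a power of every element of \<open>\<mm>\<close>.  If \<open>I\<close> were proper, there would
  therefore be some \<open>x \<notin> I\<close> with \<open>\<mm> x \<subseteq> I\<close>, and the extension property for \<open>\<mm>\<close> would allow an extension to
  \<open>I + R x\<close>.  Hence \<open>I = R\<close> (\<open>baer_of_maximal_ideal\<close>).
\<close>

section \<open>Linear maps, submodules and change of rings\<close>

lemma linear_mapI:
  assumes "\<And>x. x \<in> carrier A \<Longrightarrow> f x \<in> carrier B"
    and "\<And>x y. x \<in> carrier A \<Longrightarrow> y \<in> carrier A \<Longrightarrow> f (x \<oplus>\<^bsub>A\<^esub> y) = f x \<oplus>\<^bsub>B\<^esub> f y"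
    and "\<And>r x. r \<in> carrier R \<Longrightarrow> x \<in> carrier A \<Longrightarrow> f (r \<odot>\<^bsub>A\<^esub> x) = r \<odot>\<^bsub>B\<^esub> f x"
  shows "linear_map R A B f"
  using assms unfolding linear_map_def by blast

lemma linear_mapD:
  assumes "linear_map R A B f"
  shows "x \<in> carrier A \<Longrightarrow> f x \<in> carrier B"
    "x \<in> carrier A \<Longrightarrow> y \<in> carrier A \<Longrightarrow> f (x \<oplus>\<^bsub>A\<^esub> y) = f x \<oplus>\<^bsub>B\<^esub> f y"
    "r \<in> carrier R \<Longrightarrow> x \<in> carrier A \<Longrightarrow> f (r \<odot>\<^bsub>A\<^esub> x) = r \<odot>\<^bsub>B\<^esub> f x"
  using assms unfolding linear_map_def by blast+

lemma linear_map_zero: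
  assumes "module R A" "module R B" "linear_map R A B f"
  shows "f \<zero>\<^bsub>A\<^esub> = \<zero>\<^bsub>B\<^esub>"
proof -
  interpret A: module R A by fact
  interpret B: module R B by fact
  have "f (\<zero>\<^bsub>R\<^esub> \<odot>\<^bsub>A\<^esub> \<zero>\<^bsub>A\<^esub>) = \<zero>\<^bsub>R\<^esub> \<odot>\<^bsub>B\<^esub> f \<zero>\<^bsub>A\<^esub>" "f \<zero>\<^bsub>A\<^esub> \<in> carrier B"
    using assms(3) A.R.zero_closed A.M.zero_closed unfolding linear_map_def by blast+
  then show ?thesis by simp
qed

lemma (in module) smult_minus_one: "x \<in> carrier M \<Longrightarrow> (\<ominus> \<one>) \<odot>\<^bsub>M\<^esub> x = \<ominus>\<^bsub>M\<^esub> x"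
  by (simp add: smult_l_minus)

lemma module_add_closed:
  assumes "module R A" "x \<in> carrier A" "y \<in> carrier A"
  shows "x \<oplus>\<^bsub>A\<^esub> y \<in> carrier A"
proof -
  interpret module R A by fact
  show ?thesis using assms(2,3) by simp
qed

lemma module_sub:
  assumes "module R A" "X \<subseteq> carrier A" "\<zero>\<^bsub>A\<^esub> \<in> X"
    and add: "\<And>x y. x \<in> X \<Longrightarrow> y \<in> X \<Longrightarrow> x \<oplus>\<^bsub>A\<^esub> y \<in> X"
    and smult: "\<And>r x. r \<in> carrier R \<Longrightarrow> x \<in> X \<Longrightarrow> r \<odot>\<^bsub>A\<^esub> x \<in> X"
  shows "submodule X R A" "module R (A\<lparr>carrier := X\<rparr>)"
proof -
  interpret A: module R A by fact
  show "submodule X R A"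
  proof (rule A.submoduleI[OF assms(2,3) _ add smult])
    show "\<ominus>\<^bsub>A\<^esub> x \<in> X" if "x \<in> X" for x
      using smult[of "\<ominus>\<^bsub>R\<^esub> \<one>\<^bsub>R\<^esub>" x] that A.smult_minus_one[of x] assms(2) by auto
  qed
  then show "module R (A\<lparr>carrier := X\<rparr>)"
    using submodule.submodule_is_module assms(1) by blast
qed

lemma module_kernel:
  assumes "module R A" "module R B" "linear_map R A B f"
  shows "module R (A\<lparr>carrier := a_kernel A B f\<rparr>)"
proof -
  interpret A: module R A by fact
  interpret B: module R B by fact
  note L = linear_mapD[OF assms(3)] linear_map_zero[OF assms]
  show ?thesis
    by (rule module_sub(2)[OF assms(1)]) (auto simp: a_kernel_def' L)
qed

lemma submodule_image:
  assumes "module R A" "module R B" "linear_map R A B f"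
  shows "submodule (f ` carrier A) R B"
proof -
  interpret A: module R A by fact
  note L = linear_mapD[OF assms(3)] linear_map_zero[OF assms]
  show ?thesis
  proof (rule module_sub(1)[OF assms(2)])
    show "\<zero>\<^bsub>B\<^esub> \<in> f ` carrier A" using L(4) by (metis A.M.zero_closed imageI)
    show "x \<oplus>\<^bsub>B\<^esub> y \<in> f ` carrier A" if "x \<in> f ` carrier A" "y \<in> f ` carrier A" for x y
      using that L(2) by (metis (no_types, lifting) A.M.a_closed imageE imageI)
    show "r \<odot>\<^bsub>B\<^esub> x \<in> f ` carrier A" if "r \<in> carrier R" "x \<in> f ` carrier A" for r x
      using that L(3) by (metis (no_types, lifting) A.smult_closed imageE imageI)
  qed (use L(1) in auto)
qed

lemma linear_map_finsum:
  assumes "module R A" "module R B" "linear_map R A B u" "finite Y" "g \<in> Y \<rightarrow> carrier A"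
  shows "u (\<Oplus>\<^bsub>A\<^esub>x\<in>Y. g x) = (\<Oplus>\<^bsub>B\<^esub>x\<in>Y. u (g x))"
proof -
  interpret A: module R A by fact
  interpret B: module R B by fact
  note L = linear_mapD[OF assms(3)] linear_map_zero[OF assms(1-3)]
  from assms(4,5) show ?thesis
  proof (induction Y rule: finite_induct)
    case empty
    then show ?case using L(4) by simp
  next
    case (insert x Y)
    have *: "g \<in> Y \<rightarrow> carrier A" "g x \<in> carrier A" "(\<lambda>x. u (g x)) \<in> Y \<rightarrow> carrier B" "u (g x) \<in> carrier B"
      using insert.prems L(1) by auto
    then show ?case
      using insert.hyps insert.IH L(2)[OF *(2) A.M.finsum_closed[OF *(1)]]
      by (simp add: A.M.finsum_insert B.M.finsum_insert)
  qed
qed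

text \<open>
  The homomorphism theorem: any choice of preimages under \<open>d\<close> gives a well-defined map, because two
  preimages of the same element differ by an element of the kernel of \<open>d\<close>, which \<open>c\<close> kills.
\<close>

lemma linear_map_factor:
  assumes "module R P" "module R K" "module R M"
    and d: "linear_map R P K d" "\<And>x. x \<in> carrier K \<Longrightarrow> \<exists>p\<in>carrier P. d p = x"
    and c: "linear_map R P M c" "\<And>p. p \<in> carrier P \<Longrightarrow> d p = \<zero>\<^bsub>K\<^esub> \<Longrightarrow> c p = \<zero>\<^bsub>M\<^esub>"
  shows "\<exists>g. linear_map R K M g \<and> (\<forall>p\<in>carrier P. g (d p) = c p)"
proof -
  interpret P: module R P by fact
  interpret K: module R K by fact
  interpret M: module R M by fact
  note D = linear_mapD[OF d(1)] and C = linear_mapD[OF c(1)]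
  have eq: "c p = c q" if "p \<in> carrier P" "q \<in> carrier P" "d p = d q" for p q
  proof -
    let ?m = "(\<ominus>\<^bsub>R\<^esub> \<one>\<^bsub>R\<^esub>) \<odot>\<^bsub>P\<^esub> q"
    have m: "?m \<in> carrier P" using that by simp
    have "d (p \<oplus>\<^bsub>P\<^esub> ?m) = \<zero>\<^bsub>K\<^esub>"
      using that m D(1)[of q] by (simp add: D(2,3) K.smult_minus_one K.M.r_neg)
    then have "c (p \<oplus>\<^bsub>P\<^esub> ?m) = \<zero>\<^bsub>M\<^esub>" using c(2) that m by simp
    then have "c p \<oplus>\<^bsub>M\<^esub> \<ominus>\<^bsub>M\<^esub> c q = \<zero>\<^bsub>M\<^esub>"
      using that m C(1)[of q] by (simp add: C(2,3) M.smult_minus_one)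
    then show ?thesis using M.M.minus_equality[of "c p" "\<ominus>\<^bsub>M\<^esub> c q"] C(1) that by simp
  qed
  obtain s where s: "\<And>x. x \<in> carrier K \<Longrightarrow> s x \<in> carrier P" "\<And>x. x \<in> carrier K \<Longrightarrow> d (s x) = x"
    using d(2) by metis
  have "linear_map R K M (\<lambda>x. c (s x))"
  proof (rule linear_mapI)
    show "c (s x) \<in> carrier M" if "x \<in> carrier K" for x using C(1) s that by blast
    show "c (s (x \<oplus>\<^bsub>K\<^esub> y)) = c (s x) \<oplus>\<^bsub>M\<^esub> c (s y)" if "x \<in> carrier K" "y \<in> carrier K" for x y
      using eq[of "s (x \<oplus>\<^bsub>K\<^esub> y)" "s x \<oplus>\<^bsub>P\<^esub> s y"] that by (simp add: s C(2) D(2))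
    show "c (s (r \<odot>\<^bsub>K\<^esub> x)) = r \<odot>\<^bsub>M\<^esub> c (s x)" if "r \<in> carrier R" "x \<in> carrier K" for r x
      using eq[of "s (r \<odot>\<^bsub>K\<^esub> x)" "r \<odot>\<^bsub>P\<^esub> s x"] that by (simp add: s C(3) D(3))
  qed
  moreover have "c (s (d p)) = c p" if "p \<in> carrier P" for p
    using eq[of "s (d p)" p] s D(1) that by simp
  ultimately show ?thesis by blast
qed

lemma regular_module_sel [simp]:
  "carrier (regular_module R) = carrier R" "zero (regular_module R) = zero R"
  "add (regular_module R) = add R" "smult (regular_module R) = mult R"
  by (simp_all add: regular_module_def)

lemma restrict_scalars_sel [simp]:
  "carrier (restrict_scalars \<phi> M) = carrier M" "zero (restrict_scalars \<phi> M) = zero M"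
  "add (restrict_scalars \<phi> M) = add M" "r \<odot>\<^bsub>restrict_scalars \<phi> M\<^esub> x = \<phi> r \<odot>\<^bsub>M\<^esub> x"
  by (simp_all add: restrict_scalars_def)

lemma abelian_group_cong:
  assumes "abelian_group A" "carrier B = carrier A" "zero B = zero A" "add B = add A"
  shows "abelian_group B"
proof -
  interpret A: abelian_group A by fact
  show ?thesis
  proof (rule abelian_groupI)
    show "\<exists>y\<in>carrier B. y \<oplus>\<^bsub>B\<^esub> x = \<zero>\<^bsub>B\<^esub>" if "x \<in> carrier B" for x
      using that A.l_neg[of x] A.a_inv_closed[of x] unfolding assms(2-4) by blast
  qed (simp_all add: assms A.a_ac)
qed

lemma module_restrict_scalars:
  assumes "cring R" "\<phi> \<in> ring_hom R S" "module S M"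
  shows "module R (restrict_scalars \<phi> M)"
proof -
  interpret M: module S M by fact
  show ?thesis
    by (rule moduleI)
      (auto simp: assms(1) abelian_group_cong[OF M.abelian_group_axioms] ring_hom_closed[OF assms(2)]
        ring_hom_add[OF assms(2)] ring_hom_mult[OF assms(2)] ring_hom_one[OF assms(2)]
        M.smult_l_distr M.smult_r_distr M.smult_assoc1)
qed

lemma module_regular: "cring R \<Longrightarrow> module R (regular_module R)"
proof -
  assume "cring R"
  then interpret cring R .
  show ?thesis
    by (rule moduleI)
      (auto simp: \<open>cring R\<close> abelian_group_cong[OF abelian_group_axioms] l_distr r_distr m_assoc)
qed

section \<open>Partial linear maps\<close>

text \<open>
  A linear map from a submodule of \<open>B\<close> to \<open>M\<close>, encoded as its graph: extending the map is then enlarging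
  a set, which is the form that Zorn's lemma needs.  The last clause makes the relation single-valued,
  since the difference of two values at the same point is a value at zero.
\<close>

definition linear_graph ::
  "('r, 'x) ring_scheme \<Rightarrow> ('r, 'b, 'y) module_scheme \<Rightarrow> ('r, 'm, 'z) module_scheme \<Rightarrow> ('b \<times> 'm) set \<Rightarrow> bool" where
  "linear_graph R B M G \<longleftrightarrow>
     G \<subseteq> carrier B \<times> carrier M \<and> (\<zero>\<^bsub>B\<^esub>, \<zero>\<^bsub>M\<^esub>) \<in> G \<and>
     (\<forall>x z x' z'. (x, z) \<in> G \<and> (x', z') \<in> G \<longrightarrow> (x \<oplus>\<^bsub>B\<^esub> x', z \<oplus>\<^bsub>M\<^esub> z') \<in> G) \<and>
     (\<forall>r\<in>carrier R. \<forall>x z. (x, z) \<in> G \<longrightarrow> (r \<odot>\<^bsub>B\<^esub> x, r \<odot>\<^bsub>M\<^esub> z) \<in> G) \<and>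
     (\<forall>z. (\<zero>\<^bsub>B\<^esub>, z) \<in> G \<longrightarrow> z = \<zero>\<^bsub>M\<^esub>)"

lemma linear_graphD:
  assumes "linear_graph R B M G"
  shows "(x, z) \<in> G \<Longrightarrow> x \<in> carrier B" "(x, z) \<in> G \<Longrightarrow> z \<in> carrier M"
    "(\<zero>\<^bsub>B\<^esub>, \<zero>\<^bsub>M\<^esub>) \<in> G"
    "(x, z) \<in> G \<Longrightarrow> (x', z') \<in> G \<Longrightarrow> (x \<oplus>\<^bsub>B\<^esub> x', z \<oplus>\<^bsub>M\<^esub> z') \<in> G"
    "r \<in> carrier R \<Longrightarrow> (x, z) \<in> G \<Longrightarrow> (r \<odot>\<^bsub>B\<^esub> x, r \<odot>\<^bsub>M\<^esub> z) \<in> G"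
    "(\<zero>\<^bsub>B\<^esub>, z) \<in> G \<Longrightarrow> z = \<zero>\<^bsub>M\<^esub>"
  using assms unfolding linear_graph_def by blast+

lemma linear_graph_unique:
  assumes "module R B" "module R M" "linear_graph R B M G" "(x, z) \<in> G" "(x, z') \<in> G"
  shows "z = z'"
proof -
  interpret B: module R B by fact
  interpret M: module R M by fact
  note D = linear_graphD[OF assms(3)]
  have c: "x \<in> carrier B" "z \<in> carrier M" "z' \<in> carrier M" using D(1,2) assms by blast+
  have "(x \<oplus>\<^bsub>B\<^esub> (\<ominus>\<^bsub>R\<^esub> \<one>\<^bsub>R\<^esub>) \<odot>\<^bsub>B\<^esub> x, z \<oplus>\<^bsub>M\<^esub> (\<ominus>\<^bsub>R\<^esub> \<one>\<^bsub>R\<^esub>) \<odot>\<^bsub>M\<^esub> z') \<in> G"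
    using assms D(4) D(5) B.R.one_closed B.R.a_inv_closed by blast
  then have "(\<zero>\<^bsub>B\<^esub>, z \<oplus>\<^bsub>M\<^esub> \<ominus>\<^bsub>M\<^esub> z') \<in> G"
    using c by (simp add: B.smult_minus_one M.smult_minus_one B.M.r_neg)
  from D(6)[OF this] show ?thesis
    using c M.M.minus_equality[of z "\<ominus>\<^bsub>M\<^esub> z'"] by simp
qed

lemma linear_graph_of_map:
  assumes "module R A" "module R B" "module R M"
    and "linear_map R A B i" "inj_on i (carrier A)" "linear_map R A M f"
  shows "linear_graph R B M ((\<lambda>x. (i x, f x)) ` carrier A)"
proof -
  interpret A: module R A by fact
  interpret B: module R B by fact
  interpret M: module R M by fact
  note zero = linear_map_zero[OF assms(1,2,4)] linear_map_zero[OF assms(1,3,6)]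
  show ?thesis
    unfolding linear_graph_def
  proof (intro conjI allI impI ballI)
    show "(\<zero>\<^bsub>B\<^esub>, \<zero>\<^bsub>M\<^esub>) \<in> (\<lambda>x. (i x, f x)) ` carrier A"
      using zero A.M.zero_closed by (metis (no_types, lifting) image_eqI)
    show "z = \<zero>\<^bsub>M\<^esub>" if "(\<zero>\<^bsub>B\<^esub>, z) \<in> (\<lambda>x. (i x, f x)) ` carrier A" for z
    proof -
      from that obtain x where x: "x \<in> carrier A" "i x = \<zero>\<^bsub>B\<^esub>" "z = f x" by force
      then have "x = \<zero>\<^bsub>A\<^esub>" using assms(5) zero(1) A.M.zero_closed by (simp add: inj_on_def)
      then show ?thesis using x zero by simp
    qed
    show "(x \<oplus>\<^bsub>B\<^esub> x', z \<oplus>\<^bsub>M\<^esub> z') \<in> (\<lambda>x. (i x, f x)) ` carrier A"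
      if "(x, z) \<in> (\<lambda>x. (i x, f x)) ` carrier A \<and> (x', z') \<in> (\<lambda>x. (i x, f x)) ` carrier A" for x z x' z'
    proof -
      from that obtain u v where "u \<in> carrier A" "v \<in> carrier A" "x = i u" "z = f u" "x' = i v" "z' = f v" by blast
      then have "u \<oplus>\<^bsub>A\<^esub> v \<in> carrier A" "(x \<oplus>\<^bsub>B\<^esub> x', z \<oplus>\<^bsub>M\<^esub> z') = (i (u \<oplus>\<^bsub>A\<^esub> v), f (u \<oplus>\<^bsub>A\<^esub> v))"
        using assms(4,6) by (auto simp: linear_map_def)
      then show ?thesis by blast
    qed
    show "(r \<odot>\<^bsub>B\<^esub> x, r \<odot>\<^bsub>M\<^esub> z) \<in> (\<lambda>x. (i x, f x)) ` carrier A"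
      if "r \<in> carrier R" "(x, z) \<in> (\<lambda>x. (i x, f x)) ` carrier A" for r x z
    proof -
      from that obtain u where "u \<in> carrier A" "x = i u" "z = f u" by blast
      then have "r \<odot>\<^bsub>A\<^esub> u \<in> carrier A" "(r \<odot>\<^bsub>B\<^esub> x, r \<odot>\<^bsub>M\<^esub> z) = (i (r \<odot>\<^bsub>A\<^esub> u), f (r \<odot>\<^bsub>A\<^esub> u))"
        using assms(4,6) that by (auto simp: linear_map_def)
      then show ?thesis by blast
    qed
  qed (use assms in \<open>auto simp: linear_map_def Pi_iff\<close>)
qed

text \<open>
  To extend a partial map to the submodule generated by its domain and one more element \<open>b\<close>, a value \<open>y\<close>
  at \<open>b\<close> has to be chosen.  The choice is admissible as soon as it agrees with the old values at those
  multiples of \<open>b\<close> that already lie in the domain.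
\<close>

lemma linear_graph_adjoin:
  assumes "module R B" "module R M" "linear_graph R B M G"
    and b: "b \<in> carrier B" and y: "y \<in> carrier M"
    and compat: "\<And>r z. r \<in> carrier R \<Longrightarrow> (r \<odot>\<^bsub>B\<^esub> b, z) \<in> G \<Longrightarrow> z = r \<odot>\<^bsub>M\<^esub> y"
  shows "\<exists>G'. linear_graph R B M G' \<and> G \<subseteq> G' \<and> (b, y) \<in> G'"
proof -
  interpret B: module R B by fact
  interpret M: module R M by fact
  note D = linear_graphD[OF assms(3)]
  define G' where "G' = {(x \<oplus>\<^bsub>B\<^esub> r \<odot>\<^bsub>B\<^esub> b, z \<oplus>\<^bsub>M\<^esub> r \<odot>\<^bsub>M\<^esub> y) | x z r. (x, z) \<in> G \<and> r \<in> carrier R}"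
  have I: "(x \<oplus>\<^bsub>B\<^esub> r \<odot>\<^bsub>B\<^esub> b, z \<oplus>\<^bsub>M\<^esub> r \<odot>\<^bsub>M\<^esub> y) \<in> G'" if "(x, z) \<in> G" "r \<in> carrier R" for x z r
    using that unfolding G'_def by blast
  have sub: "G \<subseteq> G'"
  proof safe
    fix x z assume "(x, z) \<in> G"
    with I[OF this B.R.zero_closed] D(1)[OF this] D(2)[OF this] b y show "(x, z) \<in> G'" by simp
  qed
  have bG: "(b, y) \<in> G'"
    using I[OF D(3) B.R.one_closed] b y by simp
  have "linear_graph R B M G'"
    unfolding linear_graph_def
  proof (intro conjI allI impI ballI)
    show "G' \<subseteq> carrier B \<times> carrier M"
    proof safe
      fix p q assume "(p, q) \<in> G'"
      then obtain u v r where *: "(u, v) \<in> G" "r \<in> carrier R" "p = u \<oplus>\<^bsub>B\<^esub> r \<odot>\<^bsub>B\<^esub> b" "q = v \<oplus>\<^bsub>M\<^esub> r \<odot>\<^bsub>M\<^esub> y"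
        unfolding G'_def by blast
      then show "p \<in> carrier B" "q \<in> carrier M"
        using D(1)[OF *(1)] D(2)[OF *(1)] b y by simp_all
    qed
    show "(\<zero>\<^bsub>B\<^esub>, \<zero>\<^bsub>M\<^esub>) \<in> G'" using sub D(3) by blast
  next
    fix x z x' z' assume "(x, z) \<in> G' \<and> (x', z') \<in> G'"
    then obtain u v r u' v' r' where *: "(u, v) \<in> G" "r \<in> carrier R" "x = u \<oplus>\<^bsub>B\<^esub> r \<odot>\<^bsub>B\<^esub> b" "z = v \<oplus>\<^bsub>M\<^esub> r \<odot>\<^bsub>M\<^esub> y"
      "(u', v') \<in> G" "r' \<in> carrier R" "x' = u' \<oplus>\<^bsub>B\<^esub> r' \<odot>\<^bsub>B\<^esub> b" "z' = v' \<oplus>\<^bsub>M\<^esub> r' \<odot>\<^bsub>M\<^esub> y"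
      unfolding G'_def by blast
    have c: "u \<in> carrier B" "u' \<in> carrier B" "v \<in> carrier M" "v' \<in> carrier M"
      using D(1,2) * by blast+
    have "x \<oplus>\<^bsub>B\<^esub> x' = (u \<oplus>\<^bsub>B\<^esub> u') \<oplus>\<^bsub>B\<^esub> (r \<oplus>\<^bsub>R\<^esub> r') \<odot>\<^bsub>B\<^esub> b"
      using c b * by (simp add: B.smult_l_distr B.M.a_ac)
    moreover have "z \<oplus>\<^bsub>M\<^esub> z' = (v \<oplus>\<^bsub>M\<^esub> v') \<oplus>\<^bsub>M\<^esub> (r \<oplus>\<^bsub>R\<^esub> r') \<odot>\<^bsub>M\<^esub> y"
      using c y * by (simp add: M.smult_l_distr M.M.a_ac)
    ultimately show "(x \<oplus>\<^bsub>B\<^esub> x', z \<oplus>\<^bsub>M\<^esub> z') \<in> G'"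
      using I[of "u \<oplus>\<^bsub>B\<^esub> u'" "v \<oplus>\<^bsub>M\<^esub> v'" "r \<oplus>\<^bsub>R\<^esub> r'"] D(4)[OF *(1,5)] *(2,6) by simp
  next
    fix s x z assume s: "s \<in> carrier R" "(x, z) \<in> G'"
    then obtain u v r where *: "(u, v) \<in> G" "r \<in> carrier R" "x = u \<oplus>\<^bsub>B\<^esub> r \<odot>\<^bsub>B\<^esub> b" "z = v \<oplus>\<^bsub>M\<^esub> r \<odot>\<^bsub>M\<^esub> y"
      unfolding G'_def by blast
    have c: "u \<in> carrier B" "v \<in> carrier M" using D(1,2) * by blast+
    show "(s \<odot>\<^bsub>B\<^esub> x, s \<odot>\<^bsub>M\<^esub> z) \<in> G'"
      using I[of "s \<odot>\<^bsub>B\<^esub> u" "s \<odot>\<^bsub>M\<^esub> v" "s \<otimes>\<^bsub>R\<^esub> r"] D(5)[OF s(1) *(1)] *(2-4) s c b y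
      by (simp add: B.smult_r_distr M.smult_r_distr B.smult_assoc1 M.smult_assoc1)
  next
    fix z assume "(\<zero>\<^bsub>B\<^esub>, z) \<in> G'"
    then obtain u v r where *: "(u, v) \<in> G" "r \<in> carrier R" "\<zero>\<^bsub>B\<^esub> = u \<oplus>\<^bsub>B\<^esub> r \<odot>\<^bsub>B\<^esub> b" "z = v \<oplus>\<^bsub>M\<^esub> r \<odot>\<^bsub>M\<^esub> y"
      unfolding G'_def by blast
    have c: "u \<in> carrier B" "v \<in> carrier M" using D(1,2) * by blast+
    have "u = (\<ominus>\<^bsub>R\<^esub> r) \<odot>\<^bsub>B\<^esub> b"
      using c b * B.M.minus_equality[of u "r \<odot>\<^bsub>B\<^esub> b"] by (simp add: B.smult_l_minus)
    with compat[of "\<ominus>\<^bsub>R\<^esub> r" v] * have "v = (\<ominus>\<^bsub>R\<^esub> r) \<odot>\<^bsub>M\<^esub> y" by simp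
    then show "z = \<zero>\<^bsub>M\<^esub>" using * y by (simp add: M.smult_l_minus M.M.l_neg)
  qed
  with sub bG show ?thesis by blast
qed

text \<open>
  By Zorn's lemma there is an extension that cannot be enlarged.  In combination with the preceding lemma
  this means that every admissible choice of a value at a point has already been made.
\<close>

lemma linear_graph_maximal:
  assumes "module R B" "module R M" "linear_graph R B M G"
  obtains H where "linear_graph R B M H" "G \<subseteq> H"
    "\<And>b y. b \<in> carrier B \<Longrightarrow> y \<in> carrier M \<Longrightarrow>
       (\<And>r z. r \<in> carrier R \<Longrightarrow> (r \<odot>\<^bsub>B\<^esub> b, z) \<in> H \<Longrightarrow> z = r \<odot>\<^bsub>M\<^esub> y) \<Longrightarrow> (b, y) \<in> H"
proof -
  define \<A> where "\<A> = {H. linear_graph R B M H \<and> G \<subseteq> H}"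
  have "\<exists>H\<in>\<A>. \<forall>X\<in>\<A>. H \<subseteq> X \<longrightarrow> X = H"
  proof (rule subset_Zorn_nonempty)
    show "\<A> \<noteq> {}" using assms(3) by (auto simp: \<A>_def)
    fix \<C> assume ne: "\<C> \<noteq> {}" and ch: "subset.chain \<A> \<C>"
    have L: "linear_graph R B M H" "G \<subseteq> H" if "H \<in> \<C>" for H
      using ch that by (auto simp: subset.chain_def \<A>_def)
    have "linear_graph R B M (\<Union>\<C>)"
      unfolding linear_graph_def
    proof (intro conjI allI impI ballI)
      show "\<Union>\<C> \<subseteq> carrier B \<times> carrier M"
        using L(1) unfolding linear_graph_def by blast
      show "(\<zero>\<^bsub>B\<^esub>, \<zero>\<^bsub>M\<^esub>) \<in> \<Union>\<C>"
        using ne L(1) linear_graphD(3) by blast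
    next
      fix x z x' z' assume "(x, z) \<in> \<Union>\<C> \<and> (x', z') \<in> \<Union>\<C>"
      then obtain H H' where H: "H \<in> \<C>" "H' \<in> \<C>" "(x, z) \<in> H" "(x', z') \<in> H'" by blast
      then have "H \<subseteq> H' \<or> H' \<subseteq> H" using ch by (auto simp: subset.chain_def)
      then obtain K where "K \<in> \<C>" "(x, z) \<in> K" "(x', z') \<in> K" using H by blast
      then show "(x \<oplus>\<^bsub>B\<^esub> x', z \<oplus>\<^bsub>M\<^esub> z') \<in> \<Union>\<C>" using linear_graphD(4)[OF L(1)] by blast
    next
      fix r x z assume "r \<in> carrier R" "(x, z) \<in> \<Union>\<C>"
      then show "(r \<odot>\<^bsub>B\<^esub> x, r \<odot>\<^bsub>M\<^esub> z) \<in> \<Union>\<C>" using linear_graphD(5)[OF L(1)] by blast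
    next
      fix z assume "(\<zero>\<^bsub>B\<^esub>, z) \<in> \<Union>\<C>"
      then show "z = \<zero>\<^bsub>M\<^esub>" using linear_graphD(6)[OF L(1)] by blast
    qed
    moreover have "G \<subseteq> \<Union>\<C>" using ne L(2) by blast
    ultimately show "\<Union>\<C> \<in> \<A>" by (simp add: \<A>_def)
  qed
  then obtain H where "H \<in> \<A>" and maxA: "\<forall>X\<in>\<A>. H \<subseteq> X \<longrightarrow> X = H" by blast
  then have H: "linear_graph R B M H" "G \<subseteq> H" by (simp_all add: \<A>_def)
  have max: "X = H" if "linear_graph R B M X" "H \<subseteq> X" for X
    using maxA that subset_trans[OF H(2)] by (simp add: \<A>_def)
  show thesis
  proof
    show "(b, y) \<in> H"
      if "b \<in> carrier B" "y \<in> carrier M"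
        "\<And>r z. r \<in> carrier R \<Longrightarrow> (r \<odot>\<^bsub>B\<^esub> b, z) \<in> H \<Longrightarrow> z = r \<odot>\<^bsub>M\<^esub> y" for b y
      using linear_graph_adjoin[OF assms(1,2) H(1) that] max by blast
  qed (use H in auto)
qed

text \<open>
  The elements that multiply \<open>b\<close> into the domain form an ideal, and the partial map on \<open>B\<close> induces a
  linear map from this ideal to \<open>M\<close>.  An admissible value at \<open>b\<close> is precisely an element of \<open>M\<close> whose
  multiples are the values of the induced map.
\<close>

lemma linear_graph_pullback:
  assumes "module R B" "module R M" "linear_graph R B M H" "b \<in> carrier B"
  shows "linear_graph R (regular_module R) M {(r, z). r \<in> carrier R \<and> (r \<odot>\<^bsub>B\<^esub> b, z) \<in> H}"
proof -
  interpret B: module R B by fact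
  interpret M: module R M by fact
  note D = linear_graphD[OF assms(3)]
  show ?thesis
    unfolding linear_graph_def
  proof (intro conjI allI impI ballI)
    show "{(r, z). r \<in> carrier R \<and> (r \<odot>\<^bsub>B\<^esub> b, z) \<in> H} \<subseteq> carrier (regular_module R) \<times> carrier M"
      using D(2) by auto
    show "(\<zero>\<^bsub>regular_module R\<^esub>, \<zero>\<^bsub>M\<^esub>) \<in> {(r, z). r \<in> carrier R \<and> (r \<odot>\<^bsub>B\<^esub> b, z) \<in> H}"
      using D(3) assms(4) by simp
  qed (use D(4-6) assms(4) in \<open>simp_all add: B.smult_l_distr B.smult_assoc1\<close>)
qed

section \<open>Baer's criterion\<close>

text \<open>
  The domain of \<open>G\<close> is an ideal, and a linear map from \<open>R\<close> to \<open>M\<close> is multiplication by its value \<open>y\<close> at the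
  unit element.  So this is the extension property of \<open>M\<close> for the inclusions of ideals in \<open>R\<close>.
\<close>

definition baer_condition :: "('r, 'x) ring_scheme \<Rightarrow> ('r, 'm, 'z) module_scheme \<Rightarrow> bool" where
  "baer_condition R M \<longleftrightarrow>
     (\<forall>G. linear_graph R (regular_module R) M G \<longrightarrow>
       (\<exists>y\<in>carrier M. \<forall>(r, z)\<in>G. z = r \<odot>\<^bsub>M\<^esub> y))"

text \<open>
  A maximal extension to \<open>B\<close> of the given map is everywhere defined: for each \<open>b\<close> the condition, applied
  to the induced map on the ideal of those elements that multiply \<open>b\<close> into the domain, provides an
  admissible value at \<open>b\<close>.
\<close>

theorem baer_criterion:
  assumes "module R A" "module R B" "module R M" "baer_condition R M"
    and "linear_map R A B i" "inj_on i (carrier A)" "linear_map R A M f"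
  shows "\<exists>g. linear_map R B M g \<and> (\<forall>x\<in>carrier A. g (i x) = f x)"
proof -
  interpret B: module R B by fact
  interpret M: module R M by fact
  obtain H where H: "linear_graph R B M H" "(\<lambda>x. (i x, f x)) ` carrier A \<subseteq> H"
    and max: "\<And>b y. b \<in> carrier B \<Longrightarrow> y \<in> carrier M \<Longrightarrow>
       (\<And>r z. r \<in> carrier R \<Longrightarrow> (r \<odot>\<^bsub>B\<^esub> b, z) \<in> H \<Longrightarrow> z = r \<odot>\<^bsub>M\<^esub> y) \<Longrightarrow> (b, y) \<in> H"
    using linear_graph_maximal[OF assms(2,3) linear_graph_of_map[OF assms(1-3,5-7)]] by blast
  note D = linear_graphD[OF H(1)]
  have "\<exists>y. (b, y) \<in> H" if b: "b \<in> carrier B" for b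
  proof -
    obtain y where "y \<in> carrier M" "\<forall>(r, z)\<in>{(r, z). r \<in> carrier R \<and> (r \<odot>\<^bsub>B\<^esub> b, z) \<in> H}. z = r \<odot>\<^bsub>M\<^esub> y"
      using assms(4) linear_graph_pullback[OF assms(2,3) H(1) b] unfolding baer_condition_def by blast
    then show ?thesis using max[OF b] by blast
  qed
  then obtain g where g: "\<And>b. b \<in> carrier B \<Longrightarrow> (b, g b) \<in> H" by metis
  have u: "(b, z) \<in> H \<Longrightarrow> g b = z" for b z
    using linear_graph_unique[OF assms(2,3) H(1)] g D(1) by blast
  have "linear_map R B M g"
    unfolding linear_map_def
  proof (intro conjI ballI)
    show "g \<in> carrier B \<rightarrow> carrier M" using g D(2) by blast
    show "g (x \<oplus>\<^bsub>B\<^esub> y) = g x \<oplus>\<^bsub>M\<^esub> g y" if "x \<in> carrier B" "y \<in> carrier B" for x y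
      using u[OF D(4)[OF g g]] that by blast
    show "g (r \<odot>\<^bsub>B\<^esub> x) = r \<odot>\<^bsub>M\<^esub> g x" if "r \<in> carrier R" "x \<in> carrier B" for r x
      using u[OF D(5)[OF _ g]] that by blast
  qed
  moreover have "\<forall>x\<in>carrier A. g (i x) = f x" using H(2) u by blast
  ultimately show ?thesis by blast
qed

text \<open>
  Injectivity is tested on modules over the type \<open>'r + 'u\<close> only.  To test it on an ideal, the ideal is
  moved into this type.
\<close>

definition Inl_module :: "('r, 'a, 'y) module_scheme \<Rightarrow> ('r, 'a + 'u) module" where
  "Inl_module A =
     \<lparr>carrier = Inl ` carrier A, mult = undefined, one = undefined, zero = Inl \<zero>\<^bsub>A\<^esub>,
      add = (\<lambda>x y. Inl (projl x \<oplus>\<^bsub>A\<^esub> projl y)), smult = (\<lambda>r x. Inl (r \<odot>\<^bsub>A\<^esub> projl x))\<rparr>"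

lemma Inl_module_sel [simp]:
  "carrier (Inl_module A) = Inl ` carrier A" "\<zero>\<^bsub>Inl_module A\<^esub> = Inl \<zero>\<^bsub>A\<^esub>"
  "Inl x \<oplus>\<^bsub>Inl_module A\<^esub> Inl y = Inl (x \<oplus>\<^bsub>A\<^esub> y)"
  "r \<odot>\<^bsub>Inl_module A\<^esub> Inl x = Inl (r \<odot>\<^bsub>A\<^esub> x)"
  by (simp_all add: Inl_module_def)

lemma module_Inl:
  assumes "module R A"
  shows "module R (Inl_module A)"
proof -
  interpret module R A by fact
  have "\<exists>y\<in>carrier A. y \<oplus>\<^bsub>A\<^esub> x = \<zero>\<^bsub>A\<^esub>" if "x \<in> carrier A" for x
    using that M.l_neg by blast
  then show ?thesis
    by (intro moduleI[OF R.cring_axioms abelian_groupI])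
      (auto simp: M.a_ac smult_l_distr smult_r_distr smult_assoc1)
qed

lemma injective_imp_baer:
  fixes R :: "('r, 'x) ring_scheme" and M :: "('r, 'm, 'y) module_scheme"
  assumes "injective_module TYPE('r + 'u) R M"
  shows "baer_condition R M"
  unfolding baer_condition_def
proof (intro allI impI)
  fix G assume G: "linear_graph R (regular_module R) M G"
  interpret M: module R M using assms by (simp add: injective_module_def)
  note A = module_regular[OF M.R.cring_axioms]
  note D = linear_graphD[OF G, simplified]
  let ?I = "(regular_module R)\<lparr>carrier := Domain G\<rparr>"
  have I: "module R ?I"
  proof (rule module_sub(2)[OF A])
    show "Domain G \<subseteq> carrier (regular_module R)" using D(1) by auto
    show "\<zero>\<^bsub>regular_module R\<^esub> \<in> Domain G" using D(3) by auto
    show "x \<oplus>\<^bsub>regular_module R\<^esub> y \<in> Domain G" if "x \<in> Domain G" "y \<in> Domain G" for x y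
      using that D(4) by (simp add: Domain_iff) blast
    show "r \<odot>\<^bsub>regular_module R\<^esub> x \<in> Domain G" if "r \<in> carrier R" "x \<in> Domain G" for r x
      using that D(5) by (simp add: Domain_iff) blast
  qed
  let ?B = "Inl_module (regular_module R) :: ('r, 'r + 'u) module" and ?J = "Inl_module ?I :: ('r, 'r + 'u) module"
  have "\<exists>z. (r, z) \<in> G" if "r \<in> Domain G" for r using that by blast
  then obtain f where f: "\<And>r. r \<in> Domain G \<Longrightarrow> (r, f r) \<in> G" by metis
  have u: "(r, z) \<in> G \<Longrightarrow> f r = z" for r z
    using linear_graph_unique[OF A M.module_axioms G] f by blast
  have f_lin: "linear_map R ?J M (\<lambda>x. f (projl x))"
  proof (rule linear_mapI)
    show "f (projl x) \<in> carrier M" if x: "x \<in> carrier ?J" for x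
    proof -
      obtain a where "a \<in> Domain G" "x = Inl a" using x by auto
      then show ?thesis using D(2)[OF f] by simp
    qed
    show "f (projl (x \<oplus>\<^bsub>?J\<^esub> y)) = f (projl x) \<oplus>\<^bsub>M\<^esub> f (projl y)"
      if xy: "x \<in> carrier ?J" "y \<in> carrier ?J" for x y
    proof -
      obtain a b where "a \<in> Domain G" "b \<in> Domain G" "x = Inl a" "y = Inl b" using xy by auto
      then show ?thesis using u[OF D(4)[OF f f]] by simp
    qed
    show "f (projl (r \<odot>\<^bsub>?J\<^esub> x)) = r \<odot>\<^bsub>M\<^esub> f (projl x)" if r: "r \<in> carrier R" and x: "x \<in> carrier ?J" for r x
    proof -
      obtain a where "a \<in> Domain G" "x = Inl a" using x by auto
      then show ?thesis using u[OF D(5)[OF r f]] by simp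
    qed
  qed
  have J: "module R ?J" and B: "module R ?B" by (rule module_Inl[OF I], rule module_Inl[OF A])
  have incl: "linear_map R ?J ?B (\<lambda>x. x)"
  proof (rule linear_mapI)
    show "x \<in> carrier ?B" if "x \<in> carrier ?J" for x using that D(1) by (simp add: image_iff) blast
  qed (simp_all add: Inl_module_def)
  obtain g where g: "linear_map R ?B M g" "\<And>x. x \<in> carrier ?J \<Longrightarrow> g x = f (projl x)"
  proof -
    have "\<exists>g. linear_map R ?B M g \<and> (\<forall>x\<in>carrier ?J. g x = f (projl x))"
      using assms[unfolded injective_module_def, THEN conjunct2, rule_format, of ?J ?B "\<lambda>x. x" "\<lambda>x. f (projl x)"]
        incl f_lin J B by simp
    then show ?thesis using that by blast
  qed
  have one: "Inl \<one>\<^bsub>R\<^esub> \<in> carrier ?B" by simp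
  have "z = r \<odot>\<^bsub>M\<^esub> g (Inl \<one>\<^bsub>R\<^esub>)" if rz: "(r, z) \<in> G" for r z
  proof -
    have "z = g (Inl r)" using u[OF rz] g(2)[of "Inl r"] DomainI[OF rz] by simp
    also have "Inl r = r \<odot>\<^bsub>?B\<^esub> Inl \<one>\<^bsub>R\<^esub>" using D(1)[OF rz] by simp
    also have "g \<dots> = r \<odot>\<^bsub>M\<^esub> g (Inl \<one>\<^bsub>R\<^esub>)" by (rule linear_mapD(3)[OF g(1) D(1)[OF rz] one])
    finally show ?thesis .
  qed
  then show "\<exists>y\<in>carrier M. \<forall>(r, z)\<in>G. z = r \<odot>\<^bsub>M\<^esub> y" using linear_mapD(1)[OF g(1) one] by blast
qed

text \<open>
  By Baer's criterion the notion of injectivity does not depend on the type \<open>'u\<close>.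
\<close>

lemma injective_iff_baer:
  fixes R :: "('r, 'x) ring_scheme" and M :: "('r, 'm, 'y) module_scheme"
  assumes "module R M"
  shows "injective_module TYPE('r + 'u) R M \<longleftrightarrow> baer_condition R M"
proof
  show "baer_condition R M" if "injective_module TYPE('r + 'u) R M"
    using that by (rule injective_imp_baer)
  show "injective_module TYPE('r + 'u) R M" if "baer_condition R M"
    unfolding injective_module_def using assms baer_criterion that by blast
qed

section \<open>Modules that are torsion with respect to the maximal ideal\<close>

lemma (in cring) idealI_comm:
  assumes "I \<subseteq> carrier R" "\<zero> \<in> I" "\<And>a b. a \<in> I \<Longrightarrow> b \<in> I \<Longrightarrow> a \<oplus> b \<in> I"
    and "\<And>a r. a \<in> I \<Longrightarrow> r \<in> carrier R \<Longrightarrow> r \<otimes> a \<in> I"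
  shows "ideal I R"
proof (rule idealI)
  show "subgroup I (add_monoid R)"
  proof (rule add.subgroupI)
    fix a assume a: "a \<in> I"
    then have "a \<in> carrier R" using assms(1) by blast
    then have "\<ominus> a = (\<ominus> \<one>) \<otimes> a" by (simp add: l_minus)
    with assms(4)[OF a, of "\<ominus> \<one>"] show "\<ominus> a \<in> I" by simp
  qed (use assms in auto)
  show "a \<otimes> x \<in> I" if "a \<in> I" "x \<in> carrier R" for a x
    using assms(4)[OF that] m_comm[of a x] assms(1) that by auto
qed (use assms(4) ring_axioms in auto)

lemma ideal_Domain_linear_graph:
  assumes "module R M" "linear_graph R (regular_module R) M G"
  shows "ideal (Domain G) R"
proof -
  interpret M: module R M by fact
  note D = linear_graphD[OF assms(2), simplified]
  show ?thesis
  proof (rule M.R.idealI_comm)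
    show "Domain G \<subseteq> carrier R" using D(1) by blast
    show "\<zero>\<^bsub>R\<^esub> \<in> Domain G" using D(3) by blast
    show "a \<oplus>\<^bsub>R\<^esub> b \<in> Domain G" if "a \<in> Domain G" "b \<in> Domain G" for a b
      using that D(4) by blast
    show "r \<otimes>\<^bsub>R\<^esub> a \<in> Domain G" if "a \<in> Domain G" "r \<in> carrier R" for a r
      using that D(5) by blast
  qed
qed

lemma ideal_kernel_linear_graph:
  assumes "module R M" "linear_graph R (regular_module R) M G"
  shows "ideal {r. (r, \<zero>\<^bsub>M\<^esub>) \<in> G} R"
proof -
  interpret M: module R M by fact
  note D = linear_graphD[OF assms(2), simplified]
  show ?thesis
  proof (rule M.R.idealI_comm)
    show "{r. (r, \<zero>\<^bsub>M\<^esub>) \<in> G} \<subseteq> carrier R" using D(1) by blast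
    show "\<zero>\<^bsub>R\<^esub> \<in> {r. (r, \<zero>\<^bsub>M\<^esub>) \<in> G}" using D(3) by blast
    show "a \<oplus>\<^bsub>R\<^esub> b \<in> {r. (r, \<zero>\<^bsub>M\<^esub>) \<in> G}" if "a \<in> {r. (r, \<zero>\<^bsub>M\<^esub>) \<in> G}" "b \<in> {r. (r, \<zero>\<^bsub>M\<^esub>) \<in> G}" for a b
      using that D(4)[of a "\<zero>\<^bsub>M\<^esub>" b "\<zero>\<^bsub>M\<^esub>"] by simp
    show "r \<otimes>\<^bsub>R\<^esub> a \<in> {r. (r, \<zero>\<^bsub>M\<^esub>) \<in> G}" if "a \<in> {r. (r, \<zero>\<^bsub>M\<^esub>) \<in> G}" "r \<in> carrier R" for a r
      using that D(5)[of r a "\<zero>\<^bsub>M\<^esub>"] by simp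
  qed
qed

text \<open>
  This is the heart of the argument.  Let \<open>H\<close> be a maximal extension, within \<open>R\<close>, of a linear map from an
  ideal to \<open>M\<close>, and let \<open>I\<close> be its domain.

  Every \<open>a \<in> \<mm>\<close> has a power in \<open>I\<close>.  The ideals \<open>(ker H : a\<^sup>k)\<close> increase with \<open>k\<close>, so they are constant
  from some \<open>k\<close> on.  For this \<open>k\<close> the value zero at \<open>a\<^sup>k\<close> is admissible: if \<open>r a\<^sup>k \<in> I\<close>, then the value of
  \<open>H\<close> at \<open>r a\<^sup>k\<close> is killed by some \<open>a\<^sup>n\<close>, so \<open>r \<in> (ker H : a\<^sup>k\<^sup>+\<^sup>n) = (ker H : a\<^sup>k)\<close> and the value is zero.
  By maximality \<open>a\<^sup>k \<in> I\<close>.  This step replaces the lemma of Artin and Rees.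

  If \<open>I\<close> were proper, then, \<open>\<mm>\<close> being finitely generated, there would be some \<open>x \<notin> I\<close> with \<open>\<mm> x \<subseteq> I\<close>.
  The induced map \<open>r \<mapsto> H (r x)\<close> has domain \<open>\<mm>\<close>, so by hypothesis it is multiplication by some \<open>y\<close>, which is
  an admissible value at \<open>x\<close>.  This contradicts maximality.
\<close>

lemma baer_of_maximal_ideal:
  assumes "noetherian_local_ring R \<mm>" "module R M"
    and ext: "\<And>G. linear_graph R (regular_module R) M G \<Longrightarrow> Domain G = \<mm> \<Longrightarrow>
                \<exists>y\<in>carrier M. \<forall>(r, z)\<in>G. z = r \<odot>\<^bsub>M\<^esub> y"
    and torsion: "\<And>a x. a \<in> \<mm> \<Longrightarrow> x \<in> carrier M \<Longrightarrow> \<exists>n::nat. (a [^]\<^bsub>R\<^esub> n) \<odot>\<^bsub>M\<^esub> x = \<zero>\<^bsub>M\<^esub>"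
  shows "baer_condition R M"
  unfolding baer_condition_def
proof (intro allI impI)
  fix G assume G: "linear_graph R (regular_module R) M G"
  interpret M: module R M by fact
  interpret N: noetherian_ring R using assms(1) by (simp add: noetherian_local_ring_def)
  interpret \<mm>: maximalideal \<mm> R using assms(1) by (simp add: noetherian_local_ring_def local_ring_def)
  note reg = module_regular[OF M.R.cring_axioms]
  obtain H where H: "linear_graph R (regular_module R) M H" "G \<subseteq> H"
    and max: "\<And>b y. b \<in> carrier R \<Longrightarrow> y \<in> carrier M \<Longrightarrow>
       (\<And>r z. r \<in> carrier R \<Longrightarrow> (r \<otimes>\<^bsub>R\<^esub> b, z) \<in> H \<Longrightarrow> z = r \<odot>\<^bsub>M\<^esub> y) \<Longrightarrow> (b, y) \<in> H"
    using linear_graph_maximal[OF reg assms(2) G] by (auto simp: regular_module_sel)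
  note D = linear_graphD[OF H(1), simplified]
  note unique = linear_graph_unique[OF reg assms(2) H(1)]
  note pull = linear_graph_pullback[OF reg assms(2) H(1), simplified]
  interpret I: ideal "Domain H" R by (rule ideal_Domain_linear_graph[OF assms(2) H(1)])
  have powers: "\<exists>k::nat. a [^]\<^bsub>R\<^esub> k \<in> Domain H" if a: "a \<in> \<mm>" for a
  proof -
    have ac [simp]: "a \<in> carrier R" using a by (rule \<mm>.Icarr)
    define J where "J k = {r. r \<in> carrier R \<and> (r \<otimes>\<^bsub>R\<^esub> (a [^]\<^bsub>R\<^esub> k), \<zero>\<^bsub>M\<^esub>) \<in> H}" for k :: nat
    have J: "ideal (J k) R" for k
      using ideal_kernel_linear_graph[OF assms(2) pull[of "a [^]\<^bsub>R\<^esub> k"]] by (simp add: J_def)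
    have step: "J k \<subseteq> J (Suc k)" for k
    proof
      fix r assume r: "r \<in> J k"
      have "(a \<otimes>\<^bsub>R\<^esub> (r \<otimes>\<^bsub>R\<^esub> (a [^]\<^bsub>R\<^esub> k)), a \<odot>\<^bsub>M\<^esub> \<zero>\<^bsub>M\<^esub>) \<in> H"
        using D(5)[OF ac, of "r \<otimes>\<^bsub>R\<^esub> (a [^]\<^bsub>R\<^esub> k)" "\<zero>\<^bsub>M\<^esub>"] r by (simp add: J_def)
      moreover have "a \<otimes>\<^bsub>R\<^esub> (r \<otimes>\<^bsub>R\<^esub> (a [^]\<^bsub>R\<^esub> k)) = r \<otimes>\<^bsub>R\<^esub> (a [^]\<^bsub>R\<^esub> Suc k)"
        using r by (simp add: J_def M.R.m_ac)
      ultimately show "r \<in> J (Suc k)" using r by (simp add: J_def)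
    qed
    have mono: "i \<le> j \<Longrightarrow> J i \<subseteq> J j" for i j by (rule lift_Suc_mono_le) (rule step)
    have "\<Union> (range J) \<in> range J"
    proof (rule N.ideal_chain_is_trivial)
      show "subset.chain {I. ideal I R} (range J)"
        unfolding subset.chain_def
      proof (intro conjI ballI)
        fix X Y assume "X \<in> range J" "Y \<in> range J"
        then obtain i j where ij: "X = J i" "Y = J j" by blast
        show "(\<subset>)\<^sup>=\<^sup>= X Y \<or> (\<subset>)\<^sup>=\<^sup>= Y X"
          using mono[of i j] mono[of j i] nat_le_linear[of i j] unfolding ij by auto
      qed (use J in auto)
    qed simp
    then obtain k where k: "\<And>j. J j \<subseteq> J k" by blast
    have "(a [^]\<^bsub>R\<^esub> k, \<zero>\<^bsub>M\<^esub>) \<in> H"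
    proof (rule max)
      fix r z assume r: "r \<in> carrier R" and rz: "(r \<otimes>\<^bsub>R\<^esub> (a [^]\<^bsub>R\<^esub> k), z) \<in> H"
      obtain n :: nat where n: "(a [^]\<^bsub>R\<^esub> n) \<odot>\<^bsub>M\<^esub> z = \<zero>\<^bsub>M\<^esub>"
        using torsion[OF a D(2)[OF rz]] by blast
      have "((a [^]\<^bsub>R\<^esub> n) \<otimes>\<^bsub>R\<^esub> (r \<otimes>\<^bsub>R\<^esub> (a [^]\<^bsub>R\<^esub> k)), \<zero>\<^bsub>M\<^esub>) \<in> H"
        using D(5)[OF _ rz, of "a [^]\<^bsub>R\<^esub> n"] n by simp
      moreover have "(a [^]\<^bsub>R\<^esub> n) \<otimes>\<^bsub>R\<^esub> (r \<otimes>\<^bsub>R\<^esub> (a [^]\<^bsub>R\<^esub> k)) = r \<otimes>\<^bsub>R\<^esub> (a [^]\<^bsub>R\<^esub> (k + n))"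
        using r by (simp add: M.R.nat_pow_mult[symmetric] M.R.m_ac)
      ultimately have "r \<in> J (k + n)" using r by (simp add: J_def)
      then have "(r \<otimes>\<^bsub>R\<^esub> (a [^]\<^bsub>R\<^esub> k), \<zero>\<^bsub>M\<^esub>) \<in> H" using k by (auto simp: J_def)
      then show "z = r \<odot>\<^bsub>M\<^esub> \<zero>\<^bsub>M\<^esub>" using unique[OF rz] r by simp
    qed simp_all
    then show ?thesis by blast
  qed
  have one: "\<one>\<^bsub>R\<^esub> \<in> Domain H"
  proof (rule ccontr)
    assume one: "\<one>\<^bsub>R\<^esub> \<notin> Domain H"
    obtain A where A: "A \<subseteq> carrier R" "finite A" "\<mm> = Idl\<^bsub>R\<^esub> A"
      using N.finetely_gen \<mm>.is_ideal by blast
    have Am: "A \<subseteq> \<mm>" using M.R.genideal_self[OF A(1)] A(3) by simp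
    from A(2) Am have "\<exists>x\<in>carrier R. x \<notin> Domain H \<and> (\<forall>a\<in>A. a \<otimes>\<^bsub>R\<^esub> x \<in> Domain H)"
    proof (induction A rule: finite_induct)
      case empty
      show ?case using one by blast
    next
      case (insert a F)
      then obtain x where x: "x \<in> carrier R" "x \<notin> Domain H" "\<And>b. b \<in> F \<Longrightarrow> b \<otimes>\<^bsub>R\<^esub> x \<in> Domain H"
        by blast
      have a: "a \<in> \<mm>" "a \<in> carrier R" and F: "F \<subseteq> carrier R" using insert.prems \<mm>.Icarr by auto
      \<comment> \<open>The first power of \<open>a\<close> that multiplies \<open>x\<close> into the domain is positive; its predecessor moves \<open>x\<close> to
        an element that is still outside the domain but that \<open>a\<close> multiplies into it.\<close>
      define P where "P k \<longleftrightarrow> (a [^]\<^bsub>R\<^esub> k) \<otimes>\<^bsub>R\<^esub> x \<in> Domain H" for k :: nat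
      obtain k0 where "P k0"
        using powers[OF a(1)] I.I_r_closed[OF _ x(1)] unfolding P_def by blast
      then have L: "P (LEAST k. P k)" by (rule LeastI)
      moreover have "\<not> P 0" using x by (simp add: P_def)
      ultimately obtain j where j: "(LEAST k. P k) = Suc j" by (metis not0_implies_Suc)
      have nj: "\<not> P j" using not_less_Least[of j P] j by simp
      have "(a [^]\<^bsub>R\<^esub> j) \<otimes>\<^bsub>R\<^esub> x \<in> carrier R" using a x by simp
      moreover have "a \<otimes>\<^bsub>R\<^esub> ((a [^]\<^bsub>R\<^esub> j) \<otimes>\<^bsub>R\<^esub> x) \<in> Domain H"
        using L j a x by (simp add: P_def M.R.m_ac)
      moreover have "b \<otimes>\<^bsub>R\<^esub> ((a [^]\<^bsub>R\<^esub> j) \<otimes>\<^bsub>R\<^esub> x) \<in> Domain H" if b: "b \<in> F" for b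
      proof -
        have "b \<otimes>\<^bsub>R\<^esub> ((a [^]\<^bsub>R\<^esub> j) \<otimes>\<^bsub>R\<^esub> x) = (a [^]\<^bsub>R\<^esub> j) \<otimes>\<^bsub>R\<^esub> (b \<otimes>\<^bsub>R\<^esub> x)"
          using a x b F by (intro M.R.m_lcomm) auto
        then show ?thesis using I.I_l_closed[OF x(3)[OF b]] a by simp
      qed
      ultimately show ?case using nj unfolding P_def by blast
    qed
    then obtain x where x: "x \<in> carrier R" "x \<notin> Domain H" "\<And>a. a \<in> A \<Longrightarrow> a \<otimes>\<^bsub>R\<^esub> x \<in> Domain H"
      by blast
    let ?K = "{(r, z). r \<in> carrier R \<and> (r \<otimes>\<^bsub>R\<^esub> x, z) \<in> H}"
    have K: "ideal (Domain ?K) R" by (rule ideal_Domain_linear_graph[OF assms(2) pull[OF x(1)]])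
    have "A \<subseteq> Domain ?K" using x(3) A(1) by blast
    then have "\<mm> \<subseteq> Domain ?K" using M.R.genideal_minimal[OF K] A(3) by simp
    moreover have "Domain ?K \<subseteq> carrier R" by blast
    moreover have "\<one>\<^bsub>R\<^esub> \<notin> Domain ?K" using x by (auto simp: Domain_iff)
    ultimately have "Domain ?K = \<mm>" using \<mm>.I_maximal[OF K] M.R.one_closed by blast
    then obtain y where y: "y \<in> carrier M" "\<forall>(r, z)\<in>?K. z = r \<odot>\<^bsub>M\<^esub> y"
      using ext[OF pull[OF x(1)]] by blast
    then have "(x, y) \<in> H" using max[OF x(1) y(1)] by blast
    then show False using x(2) by blast
  qed
  then obtain y where y: "(\<one>\<^bsub>R\<^esub>, y) \<in> H" by blast
  have "z = r \<odot>\<^bsub>M\<^esub> y" if "(r, z) \<in> G" for r z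
  proof -
    have "(r, z) \<in> H" using that H(2) by blast
    moreover have "(r, r \<odot>\<^bsub>M\<^esub> y) \<in> H" using D(5)[OF D(1)[OF calculation] y] D(1)[OF calculation] by simp
    ultimately show ?thesis by (rule unique)
  qed
  then show "\<exists>y\<in>carrier M. \<forall>(r, z)\<in>G. z = r \<odot>\<^bsub>M\<^esub> y" using D(2)[OF y] by blast
qed

section \<open>Artinian modules over a local ring\<close>

lemma local_ring_unit:
  assumes "noetherian_local_ring S \<nn>" "a \<in> carrier S" "a \<notin> \<nn>"
  shows "a \<in> Units S"
proof (rule ccontr)
  assume nu: "a \<notin> Units S"
  interpret cring S using assms(1) by (simp add: noetherian_local_ring_def local_ring_def)
  interpret N: noetherian_ring S using assms(1) by (simp add: noetherian_local_ring_def)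
  define \<A> where "\<A> = {I. ideal I S \<and> I \<noteq> carrier S \<and> PIdl\<^bsub>S\<^esub> a \<subseteq> I}"
  have "PIdl\<^bsub>S\<^esub> a \<noteq> carrier S"
  proof
    assume "PIdl\<^bsub>S\<^esub> a = carrier S"
    then obtain b where "b \<in> carrier S" "\<one>\<^bsub>S\<^esub> = b \<otimes>\<^bsub>S\<^esub> a" using one_closed unfolding cgenideal_def by blast
    then show False using nu assms(2) m_comm unfolding Units_def by (metis (mono_tags, lifting) mem_Collect_eq)
  qed
  then have ne: "\<A> \<noteq> {}" using cgenideal_ideal[OF assms(2)] by (auto simp: \<A>_def)
  have "\<exists>J\<in>\<A>. \<forall>X\<in>\<A>. J \<subseteq> X \<longrightarrow> X = J"
  proof (rule subset_Zorn_nonempty[OF ne])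
    fix \<C> assume C: "\<C> \<noteq> {}" "subset.chain \<A> \<C>"
    then have "subset.chain {I. ideal I S} \<C>" by (auto simp: subset.chain_def \<A>_def)
    then have "\<Union>\<C> \<in> \<C>" by (rule N.ideal_chain_is_trivial[OF C(1)])
    then show "\<Union>\<C> \<in> \<A>" using C(2) by (auto simp: subset.chain_def)
  qed
  then obtain J where J: "J \<in> \<A>" "\<forall>X\<in>\<A>. J \<subseteq> X \<longrightarrow> X = J" by blast
  have "maximalideal J S"
  proof (rule maximalidealI)
    show "ideal J S" "carrier S \<noteq> J" using J(1) by (auto simp: \<A>_def)
    show "X = J \<or> X = carrier S" if "ideal X S" "J \<subseteq> X" "X \<subseteq> carrier S" for X
    proof (cases "X = carrier S")
      case False
      then have "X \<in> \<A>" using that J(1) by (auto simp: \<A>_def)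
      then show ?thesis using J(2) that by blast
    qed simp
  qed
  then have "J = \<nn>" using assms(1) by (simp add: noetherian_local_ring_def local_ring_def)
  then have "a \<in> \<nn>" using J(1) cgenideal_self[OF assms(2)] by (auto simp: \<A>_def)
  then show False using assms(3) by simp
qed

text \<open>
  The descending chain of submodules generated by the \<open>s\<^sup>i x\<close> stabilises, so \<open>s\<^sup>n x = s\<^sup>n\<^sup>+\<^sup>1 u x\<close> for some \<open>n\<close> and
  \<open>u\<close>.  Since \<open>1 - s u\<close> kills \<open>s\<^sup>n x\<close> and is a unit, \<open>s\<^sup>n x = 0\<close>.
\<close>

lemma artinian_torsion:
  assumes "noetherian_local_ring S \<nn>" "artinian_module S M" "s \<in> \<nn>" "x \<in> carrier M"
  shows "\<exists>n::nat. (s [^]\<^bsub>S\<^esub> n) \<odot>\<^bsub>M\<^esub> x = \<zero>\<^bsub>M\<^esub>"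
proof -
  interpret M: module S M using assms(2) by (simp add: artinian_module_def)
  interpret \<nn>: maximalideal \<nn> S using assms(1) by (simp add: noetherian_local_ring_def local_ring_def)
  have s: "s \<in> carrier S" using assms(3) by (rule \<nn>.Icarr)
  define N where "N i = {((s [^]\<^bsub>S\<^esub> i) \<otimes>\<^bsub>S\<^esub> u) \<odot>\<^bsub>M\<^esub> x | u. u \<in> carrier S}" for i :: nat
  have I: "((s [^]\<^bsub>S\<^esub> i) \<otimes>\<^bsub>S\<^esub> u) \<odot>\<^bsub>M\<^esub> x \<in> N i" if "u \<in> carrier S" for i u
    using that unfolding N_def by blast
  have E: "\<exists>u\<in>carrier S. y = ((s [^]\<^bsub>S\<^esub> i) \<otimes>\<^bsub>S\<^esub> u) \<odot>\<^bsub>M\<^esub> x" if "y \<in> N i" for i y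
    using that unfolding N_def by blast
  have "submodule (N i) S M" for i
  proof (rule M.submoduleI)
    show "N i \<subseteq> carrier M" using s assms(4) by (auto simp: N_def)
    show "\<zero>\<^bsub>M\<^esub> \<in> N i" using I[OF M.R.zero_closed, of i] s assms(4) by simp
    fix a assume a: "a \<in> N i"
    then obtain u where u: "u \<in> carrier S" "a = ((s [^]\<^bsub>S\<^esub> i) \<otimes>\<^bsub>S\<^esub> u) \<odot>\<^bsub>M\<^esub> x" using E by blast
    show "\<ominus>\<^bsub>M\<^esub> a \<in> N i"
      using I[of "\<ominus>\<^bsub>S\<^esub> u" i] u s assms(4) by (simp add: M.R.r_minus M.smult_l_minus)
    show "r \<odot>\<^bsub>M\<^esub> a \<in> N i" if "r \<in> carrier S" for r
    proof -
      have "r \<odot>\<^bsub>M\<^esub> a = ((s [^]\<^bsub>S\<^esub> i) \<otimes>\<^bsub>S\<^esub> (r \<otimes>\<^bsub>S\<^esub> u)) \<odot>\<^bsub>M\<^esub> x"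
        using that s assms(4) u by (simp add: M.smult_assoc1[symmetric] M.R.m_ac)
      then show ?thesis using I u that by simp
    qed
    fix b assume "b \<in> N i"
    then obtain v where v: "v \<in> carrier S" "b = ((s [^]\<^bsub>S\<^esub> i) \<otimes>\<^bsub>S\<^esub> v) \<odot>\<^bsub>M\<^esub> x" using E by blast
    show "a \<oplus>\<^bsub>M\<^esub> b \<in> N i"
      using I[of "u \<oplus>\<^bsub>S\<^esub> v" i] u v s assms(4) by (simp add: M.R.r_distr M.smult_l_distr)
  qed
  moreover have "N (Suc i) \<subseteq> N i" for i
  proof
    fix y assume "y \<in> N (Suc i)"
    then obtain u where u: "u \<in> carrier S" "y = ((s [^]\<^bsub>S\<^esub> Suc i) \<otimes>\<^bsub>S\<^esub> u) \<odot>\<^bsub>M\<^esub> x" using E by blast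
    then show "y \<in> N i" using I[of "s \<otimes>\<^bsub>S\<^esub> u" i] s by (simp add: M.R.m_assoc)
  qed
  ultimately obtain n where n: "\<And>i. i \<ge> n \<Longrightarrow> N i = N n"
    using assms(2) unfolding artinian_module_def by meson
  let ?z = "(s [^]\<^bsub>S\<^esub> n) \<odot>\<^bsub>M\<^esub> x"
  have z: "?z \<in> carrier M" using s assms(4) by simp
  have "?z \<in> N (Suc n)" using n[of "Suc n"] I[OF M.R.one_closed, of n] s by simp
  then obtain u where u: "u \<in> carrier S" "?z = ((s [^]\<^bsub>S\<^esub> Suc n) \<otimes>\<^bsub>S\<^esub> u) \<odot>\<^bsub>M\<^esub> x" using E by blast
  have su: "s \<otimes>\<^bsub>S\<^esub> u \<in> \<nn>" using \<nn>.I_r_closed assms(3) u(1) by blast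
  let ?e = "\<one>\<^bsub>S\<^esub> \<oplus>\<^bsub>S\<^esub> \<ominus>\<^bsub>S\<^esub> (s \<otimes>\<^bsub>S\<^esub> u)"
  have e: "?e \<in> carrier S" using s u by simp
  have "?e \<notin> \<nn>"
  proof
    assume "?e \<in> \<nn>"
    then have "?e \<oplus>\<^bsub>S\<^esub> s \<otimes>\<^bsub>S\<^esub> u \<in> \<nn>" using su \<nn>.a_closed by blast
    then have "\<one>\<^bsub>S\<^esub> \<in> \<nn>" using s u by (simp add: M.R.a_assoc M.R.l_neg)
    then show False using \<nn>.one_imp_carrier \<nn>.I_notcarr by blast
  qed
  then have eu: "?e \<in> Units S" using local_ring_unit[OF assms(1) e] by blast
  have "?z = (s \<otimes>\<^bsub>S\<^esub> u) \<odot>\<^bsub>M\<^esub> ?z"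
  proof -
    have "(s [^]\<^bsub>S\<^esub> Suc n) \<otimes>\<^bsub>S\<^esub> u = (s \<otimes>\<^bsub>S\<^esub> u) \<otimes>\<^bsub>S\<^esub> (s [^]\<^bsub>S\<^esub> n)"
      using s u(1) by (simp add: M.R.m_ac)
    then show ?thesis using u s assms(4) by (simp add: M.smult_assoc1)
  qed
  then have "?e \<odot>\<^bsub>M\<^esub> ?z = \<zero>\<^bsub>M\<^esub>"
    using s u(1) z by (simp add: M.smult_l_distr M.smult_l_minus M.M.r_neg)
  then have "inv\<^bsub>S\<^esub> ?e \<odot>\<^bsub>M\<^esub> (?e \<odot>\<^bsub>M\<^esub> ?z) = \<zero>\<^bsub>M\<^esub>" using eu by simp
  then have "?z = \<zero>\<^bsub>M\<^esub>"
    using eu e z by (simp add: M.smult_assoc1[symmetric])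
  then show ?thesis by blast
qed

section \<open>Modules of homomorphisms and homology\<close>

lemma Hom_module_sel:
  "f \<in> carrier (Hom_module R A B) \<longleftrightarrow> f \<in> extensional (carrier A) \<and> linear_map R A B f"
  "\<zero>\<^bsub>Hom_module R A B\<^esub> = (\<lambda>x\<in>carrier A. \<zero>\<^bsub>B\<^esub>)"
  "f \<oplus>\<^bsub>Hom_module R A B\<^esub> g = (\<lambda>x\<in>carrier A. f x \<oplus>\<^bsub>B\<^esub> g x)"
  "r \<odot>\<^bsub>Hom_module R A B\<^esub> f = (\<lambda>x\<in>carrier A. r \<odot>\<^bsub>B\<^esub> f x)"
  by (simp_all add: Hom_module_def)

lemma module_Hom:
  assumes "module R A" "module R B"
  shows "module R (Hom_module R A B)"
proof -
  interpret A: module R A by fact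
  interpret B: module R B by fact
  let ?H = "Hom_module R A B"
  have L: "f x \<in> carrier B" "y \<in> carrier A \<Longrightarrow> f (x \<oplus>\<^bsub>A\<^esub> y) = f x \<oplus>\<^bsub>B\<^esub> f y"
    "r \<in> carrier R \<Longrightarrow> f (r \<odot>\<^bsub>A\<^esub> x) = r \<odot>\<^bsub>B\<^esub> f x"
    if "f \<in> carrier ?H" "x \<in> carrier A" for f x y r
    using that linear_mapD[of R A B f] by (simp_all add: Hom_module_sel)
  have ext: "f x = undefined" if "f \<in> carrier ?H" "x \<notin> carrier A" for f x
    using that by (simp add: Hom_module_sel extensional_def)
  have smult: "r \<odot>\<^bsub>?H\<^esub> f \<in> carrier ?H" if "r \<in> carrier R" "f \<in> carrier ?H" for r f
    using that unfolding Hom_module_sel(1,4)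
    by (intro conjI restrict_extensional linear_mapI)
      (simp_all add: L that B.smult_r_distr B.smult_assoc1[symmetric] A.R.m_comm)
  have add: "f \<oplus>\<^bsub>?H\<^esub> g \<in> carrier ?H" if "f \<in> carrier ?H" "g \<in> carrier ?H" for f g
    unfolding Hom_module_sel(1,3)
    by (intro conjI restrict_extensional linear_mapI)
      (simp_all add: L[OF that(1)] L[OF that(2)] B.smult_r_distr B.M.a_ac)
  have zero: "\<zero>\<^bsub>?H\<^esub> \<in> carrier ?H"
    unfolding Hom_module_sel(1,2) by (intro conjI restrict_extensional linear_mapI) simp_all
  note sel = Hom_module_sel(2-4)
  show ?thesis
  proof (rule moduleI[OF A.R.cring_axioms abelian_groupI])
    fix f assume f: "f \<in> carrier ?H"
    show "\<exists>g\<in>carrier ?H. g \<oplus>\<^bsub>?H\<^esub> f = \<zero>\<^bsub>?H\<^esub>"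
    proof
      show "(\<ominus>\<^bsub>R\<^esub> \<one>\<^bsub>R\<^esub>) \<odot>\<^bsub>?H\<^esub> f \<in> carrier ?H" using smult f by simp
      show "(\<ominus>\<^bsub>R\<^esub> \<one>\<^bsub>R\<^esub>) \<odot>\<^bsub>?H\<^esub> f \<oplus>\<^bsub>?H\<^esub> f = \<zero>\<^bsub>?H\<^esub>"
        using f L(1) by (auto simp: sel fun_eq_iff B.smult_minus_one B.M.l_neg)
    qed
  qed (auto simp: smult add zero, auto simp: sel fun_eq_iff L(1) ext B.M.a_assoc B.M.a_comm B.M.a_lcomm
      B.smult_l_distr B.smult_r_distr B.smult_assoc1)
qed

lemma linear_Hom_map:
  assumes "module R B" "linear_map R A A' d"
    and "module R A"  "module R A'"
  shows "linear_map R (Hom_module R A' B) (Hom_module R A B) (Hom_map A d)"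
proof -
  interpret B: module R B by fact
  interpret A: module R A by fact
  note D = linear_mapD[OF assms(2)]
  show ?thesis
  proof (rule linear_mapI)
    show "Hom_map A d f \<in> carrier (Hom_module R A B)" if "f \<in> carrier (Hom_module R A' B)" for f
      using that linear_mapD[of R A' B f] D unfolding Hom_module_sel(1) Hom_map_def
      by (intro conjI restrict_extensional linear_mapI) auto
  qed (auto simp: Hom_module_sel Hom_map_def fun_eq_iff D)
qed

lemma zero_homology_iff:
  assumes "module R A" "module R B" "module R C" "linear_map R A B f" "linear_map R B C g"
    and complex: "\<And>x. x \<in> carrier A \<Longrightarrow> g (f x) = \<zero>\<^bsub>C\<^esub>"
  shows "zero_module (homology_module A f B g C) \<longleftrightarrow> a_kernel B C g \<subseteq> f ` carrier A"
proof -
  let ?K = "B\<lparr>carrier := a_kernel B C g\<rparr>"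
  interpret K: module R ?K by (rule module_kernel[OF assms(2,3,5)])
  have "linear_map R A ?K f"
    using assms(4) complex by (auto simp: linear_map_def a_kernel_def' Pi_iff)
  then have sub: "submodule (f ` carrier A) R ?K"
    by (rule submodule_image[OF assms(1) K.module_axioms])
  then have grp: "subgroup (f ` carrier A) (add_monoid ?K)" by (rule submodule.axioms)
  have "zero_module (homology_module A f B g C) \<longleftrightarrow> a_rcosets\<^bsub>?K\<^esub> (f ` carrier A) = {f ` carrier A}"
    by (simp add: zero_module_def homology_module_def quotient_module_def)
  also have "\<dots> \<longleftrightarrow> (\<forall>x\<in>carrier ?K. f ` carrier A +>\<^bsub>?K\<^esub> x = f ` carrier A)"
    unfolding A_RCOSETS_def' using K.M.zero_closed by blast
  also have "\<dots> \<longleftrightarrow> carrier ?K \<subseteq> f ` carrier A"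
    unfolding a_r_coset_def
    using K.M.add.coset_join1[OF _ _ grp] K.M.add.coset_join2[OF _ grp] by auto
  finally show ?thesis by simp
qed

section \<open>Free modules\<close>

lemma free_module_sel [simp]:
  "\<zero>\<^bsub>free_module R X\<^esub> = (\<lambda>x. \<zero>\<^bsub>R\<^esub>)"
  "f \<oplus>\<^bsub>free_module R X\<^esub> g = (\<lambda>x. f x \<oplus>\<^bsub>R\<^esub> g x)"
  "r \<odot>\<^bsub>free_module R X\<^esub> f = (\<lambda>x. r \<otimes>\<^bsub>R\<^esub> f x)"
  by (simp_all add: free_module_def)

lemma free_moduleD:
  assumes "f \<in> carrier (free_module R X)"
  shows "x \<in> X \<Longrightarrow> f x \<in> carrier R" "x \<notin> X \<Longrightarrow> f x = \<zero>\<^bsub>R\<^esub>" "finite {x. f x \<noteq> \<zero>\<^bsub>R\<^esub>}"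
  using assms by (simp_all add: free_module_def)

lemma module_free:
  assumes "cring R"
  shows "module R (free_module R X)"
proof -
  interpret cring R by fact
  have c: "f x \<in> carrier R" if "f \<in> carrier (free_module R X)" for f x
    using free_moduleD(1,2)[OF that, of x] by (cases "x \<in> X") simp_all
  have fin: "finite {x. h x \<noteq> \<zero>\<^bsub>R\<^esub>}"
    if "f \<in> carrier (free_module R X)" "g \<in> carrier (free_module R X)"
      "\<And>x. f x = \<zero>\<^bsub>R\<^esub> \<Longrightarrow> g x = \<zero>\<^bsub>R\<^esub> \<Longrightarrow> h x = \<zero>\<^bsub>R\<^esub>" for f g h
    by (rule finite_subset[of _ "{x. f x \<noteq> \<zero>\<^bsub>R\<^esub>} \<union> {x. g x \<noteq> \<zero>\<^bsub>R\<^esub>}"])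
      (use that free_moduleD(3) in auto)
  have zero: "\<zero>\<^bsub>free_module R X\<^esub> \<in> carrier (free_module R X)"
    by (simp add: free_module_def)
  have add: "f \<oplus>\<^bsub>free_module R X\<^esub> g \<in> carrier (free_module R X)"
    if "f \<in> carrier (free_module R X)" "g \<in> carrier (free_module R X)" for f g
    using fin[OF that, of "\<lambda>x. f x \<oplus>\<^bsub>R\<^esub> g x"] that by (simp add: free_module_def)
  have smult: "r \<odot>\<^bsub>free_module R X\<^esub> f \<in> carrier (free_module R X)"
    if "r \<in> carrier R" "f \<in> carrier (free_module R X)" for r f
    using fin[OF that(2,2), of "\<lambda>x. r \<otimes>\<^bsub>R\<^esub> f x"] that by (simp add: free_module_def)
  show ?thesis
  proof (rule moduleI[OF cring_axioms abelian_groupI])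
    fix f assume f: "f \<in> carrier (free_module R X)"
    show "\<exists>g\<in>carrier (free_module R X). g \<oplus>\<^bsub>free_module R X\<^esub> f = \<zero>\<^bsub>free_module R X\<^esub>"
    proof
      show "(\<ominus>\<^bsub>R\<^esub> \<one>\<^bsub>R\<^esub>) \<odot>\<^bsub>free_module R X\<^esub> f \<in> carrier (free_module R X)" using smult f by simp
      show "(\<ominus>\<^bsub>R\<^esub> \<one>\<^bsub>R\<^esub>) \<odot>\<^bsub>free_module R X\<^esub> f \<oplus>\<^bsub>free_module R X\<^esub> f = \<zero>\<^bsub>free_module R X\<^esub>"
        using c[OF f] by (simp add: l_minus l_neg)
    qed
  qed (fact smult add zero | simp add: c a_ac l_distr r_distr m_assoc)+
qed

definition basis_vector :: "('r, 'x) ring_scheme \<Rightarrow> 'a \<Rightarrow> 'a \<Rightarrow> 'r" where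
  "basis_vector R x = (\<lambda>y. if y = x then \<one>\<^bsub>R\<^esub> else \<zero>\<^bsub>R\<^esub>)"

lemma basis_vector_closed:
  assumes "cring R" "x \<in> X"
  shows "basis_vector R x \<in> carrier (free_module R X)"
proof -
  interpret cring R by fact
  have "finite {y. basis_vector R x y \<noteq> \<zero>\<^bsub>R\<^esub>}"
    by (rule finite_subset[of _ "{x}"]) (auto simp: basis_vector_def)
  then show ?thesis using assms(2) by (auto simp: free_module_def basis_vector_def)
qed

text \<open>
  The linear map on the free module on \<open>X\<close> that sends the basis vector of \<open>x\<close> to \<open>w x\<close>.  The free cover of a
  module is the special case in which \<open>w\<close> is the identity.
\<close>

definition free_lift ::
  "('r, 'x) ring_scheme \<Rightarrow> ('r, 'n, 'y) module_scheme \<Rightarrow> 'a set \<Rightarrow> ('a \<Rightarrow> 'n) \<Rightarrow> ('a \<Rightarrow> 'r) \<Rightarrow> 'n" where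
  "free_lift R N X w f = (\<Oplus>\<^bsub>N\<^esub>x\<in>{x \<in> X. f x \<noteq> \<zero>\<^bsub>R\<^esub>}. f x \<odot>\<^bsub>N\<^esub> w x)"

text \<open>
  Additivity compares the sums for two elements with different supports, so both have to be taken over a
  common index set.
\<close>

lemma free_lift_superset:
  assumes "module R N" "f \<in> carrier (free_module R X)" "w \<in> X \<rightarrow> carrier N"
    and "finite Y" "{x. f x \<noteq> \<zero>\<^bsub>R\<^esub>} \<subseteq> Y" "Y \<subseteq> X"
  shows "free_lift R N X w f = (\<Oplus>\<^bsub>N\<^esub>x\<in>Y. f x \<odot>\<^bsub>N\<^esub> w x)"
proof -
  interpret N: module R N by fact
  have w: "w x \<in> carrier N" if "x \<in> X" for x using that assms(3) by blast
  note f = free_moduleD[OF assms(2)]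
  show ?thesis
    unfolding free_lift_def
    by (rule N.M.add.finprod_mono_neutral_cong_left) (use assms(4-6) f(1) w in auto)
qed

lemma linear_free_lift:
  assumes "module R N" "w \<in> X \<rightarrow> carrier N"
  shows "linear_map R (free_module R X) N (free_lift R N X w)"
proof -
  interpret N: module R N by fact
  interpret P: module R "free_module R X" by (rule module_free[OF N.R.cring_axioms])
  have w: "w x \<in> carrier N" if "x \<in> X" for x using that assms(2) by blast
  note sup = free_lift_superset[OF assms(1) _ assms(2)]
  have supp: "finite {x. f x \<noteq> \<zero>\<^bsub>R\<^esub>}" "{x. f x \<noteq> \<zero>\<^bsub>R\<^esub>} \<subseteq> X" if "f \<in> carrier (free_module R X)" for f
    using free_moduleD[OF that] by auto
  note cl = free_moduleD(1)
  show ?thesis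
  proof (rule linear_mapI)
    fix f assume f: "f \<in> carrier (free_module R X)"
    show "free_lift R N X w f \<in> carrier N"
      unfolding free_lift_def using cl[OF f] w by (auto intro!: N.M.finsum_closed)
    {
      fix g assume g: "g \<in> carrier (free_module R X)"
      let ?Y = "{x. f x \<noteq> \<zero>\<^bsub>R\<^esub>} \<union> {x. g x \<noteq> \<zero>\<^bsub>R\<^esub>}"
      have Y: "finite ?Y" "?Y \<subseteq> X" using supp f g by auto
      have fg: "f \<oplus>\<^bsub>free_module R X\<^esub> g \<in> carrier (free_module R X)" using f g by (rule P.M.a_closed)
      have "free_lift R N X w (f \<oplus>\<^bsub>free_module R X\<^esub> g) = (\<Oplus>\<^bsub>N\<^esub>x\<in>?Y. (f x \<oplus>\<^bsub>R\<^esub> g x) \<odot>\<^bsub>N\<^esub> w x)"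
        by (subst sup[OF fg Y(1) _ Y(2)]) auto
      also have "\<dots> = (\<Oplus>\<^bsub>N\<^esub>x\<in>?Y. f x \<odot>\<^bsub>N\<^esub> w x \<oplus>\<^bsub>N\<^esub> g x \<odot>\<^bsub>N\<^esub> w x)"
        by (rule N.M.finsum_cong') (use Y cl[OF f] cl[OF g] w in \<open>auto simp: N.smult_l_distr subset_iff\<close>)
      also have "\<dots> = (\<Oplus>\<^bsub>N\<^esub>x\<in>?Y. f x \<odot>\<^bsub>N\<^esub> w x) \<oplus>\<^bsub>N\<^esub> (\<Oplus>\<^bsub>N\<^esub>x\<in>?Y. g x \<odot>\<^bsub>N\<^esub> w x)"
        by (rule N.M.finsum_addf) (use Y cl[OF f] cl[OF g] w in \<open>auto simp: subset_iff\<close>)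
      also have "\<dots> = free_lift R N X w f \<oplus>\<^bsub>N\<^esub> free_lift R N X w g"
        by (subst (1 2) sup[OF _ Y(1) _ Y(2)]) (use f g in auto)
      finally show "free_lift R N X w (f \<oplus>\<^bsub>free_module R X\<^esub> g) = free_lift R N X w f \<oplus>\<^bsub>N\<^esub> free_lift R N X w g" .
    }
    fix r assume r: "r \<in> carrier R"
    let ?Y = "{x. f x \<noteq> \<zero>\<^bsub>R\<^esub>}"
    have rf: "r \<odot>\<^bsub>free_module R X\<^esub> f \<in> carrier (free_module R X)" using r f by (rule P.smult_closed)
    have Y: "finite ?Y" "?Y \<subseteq> X" using supp f by auto
    have "free_lift R N X w (r \<odot>\<^bsub>free_module R X\<^esub> f) = (\<Oplus>\<^bsub>N\<^esub>x\<in>?Y. (r \<otimes>\<^bsub>R\<^esub> f x) \<odot>\<^bsub>N\<^esub> w x)"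
      by (subst sup[OF rf Y(1) _ Y(2)]) (use r in auto)
    also have "\<dots> = (\<Oplus>\<^bsub>N\<^esub>x\<in>?Y. r \<odot>\<^bsub>N\<^esub> (f x \<odot>\<^bsub>N\<^esub> w x))"
      by (rule N.M.finsum_cong') (use Y cl[OF f] r w in \<open>auto simp: N.smult_assoc1 subset_iff\<close>)
    also have "\<dots> = r \<odot>\<^bsub>N\<^esub> (\<Oplus>\<^bsub>N\<^esub>x\<in>?Y. f x \<odot>\<^bsub>N\<^esub> w x)"
      by (rule N.finsum_smult_ldistr[symmetric]) (use Y cl[OF f] r w in \<open>auto simp: subset_iff\<close>)
    also have "\<dots> = r \<odot>\<^bsub>N\<^esub> free_lift R N X w f"
      by (subst sup[OF f Y(1) _ Y(2)]) auto
    finally show "free_lift R N X w (r \<odot>\<^bsub>free_module R X\<^esub> f) = r \<odot>\<^bsub>N\<^esub> free_lift R N X w f" .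
  qed
qed

lemma free_lift_basis_vector:
  assumes "module R N" "w \<in> X \<rightarrow> carrier N" "x \<in> X"
  shows "free_lift R N X w (basis_vector R x) = w x"
proof -
  interpret N: module R N by fact
  have "free_lift R N X w (basis_vector R x) = (\<Oplus>\<^bsub>N\<^esub>y\<in>{x}. basis_vector R x y \<odot>\<^bsub>N\<^esub> w y)"
    by (rule free_lift_superset[OF assms(1) basis_vector_closed[OF N.R.cring_axioms assms(3)] assms(2)])
      (use assms(3) in \<open>auto simp: basis_vector_def\<close>)
  also have "\<dots> = w x"
    using assms(2,3) by (simp add: N.M.finsum_insert basis_vector_def Pi_iff)
  finally show ?thesis .
qed

lemma linear_map_free_lift:
  assumes "module R A" "module R B" "linear_map R A B u" "w \<in> X \<rightarrow> carrier A"
    and f: "f \<in> carrier (free_module R X)"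
  shows "u (free_lift R A X w f) = free_lift R B X (\<lambda>x. u (w x)) f"
proof -
  interpret A: module R A by fact
  interpret B: module R B by fact
  note L = linear_mapD[OF assms(3)]
  have fin: "finite {x \<in> X. f x \<noteq> \<zero>\<^bsub>R\<^esub>}" using free_moduleD(3)[OF f] by simp
  have w: "w x \<in> carrier A" if "x \<in> X" for x using that assms(4) by blast
  have "u (free_lift R A X w f) = (\<Oplus>\<^bsub>B\<^esub>x\<in>{x \<in> X. f x \<noteq> \<zero>\<^bsub>R\<^esub>}. u (f x \<odot>\<^bsub>A\<^esub> w x))"
    unfolding free_lift_def
    by (rule linear_map_finsum[OF assms(1-3) fin]) (use w free_moduleD(1)[OF f] in auto)
  also have "\<dots> = free_lift R B X (\<lambda>x. u (w x)) f"
    unfolding free_lift_def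
    by (rule B.M.finsum_cong') (use w free_moduleD(1)[OF f] L(1,3) in auto)
  finally show ?thesis .
qed

lemma cover_map_eq_free_lift: "cover_map R N = free_lift R N (carrier N) (\<lambda>x. x)"
  by (simp add: fun_eq_iff cover_map_def free_lift_def)

lemma linear_cover_map: "module R N \<Longrightarrow> linear_map R (free_cover R N) N (cover_map R N)"
  unfolding cover_map_eq_free_lift free_cover_def by (rule linear_free_lift) auto

lemma cover_map_basis_vector:
  assumes "module R N" "x \<in> carrier N"
  shows "cover_map R N (basis_vector R x) = x"
  using free_lift_basis_vector[OF assms(1), of "\<lambda>x. x" "carrier N" x] assms(2)
  by (simp add: cover_map_eq_free_lift)

lemma module_free_cover: "cring R \<Longrightarrow> module R (free_cover R N)"
  unfolding free_cover_def by (rule module_free)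

lemma cover_map_surj:
  assumes "module R N" "x \<in> carrier N"
  shows "\<exists>p\<in>carrier (free_cover R N). cover_map R N p = x"
proof -
  interpret module R N by fact
  show ?thesis
    using cover_map_basis_vector[OF assms] basis_vector_closed[OF R.cring_axioms assms(2)]
    unfolding free_cover_def by blast
qed

lemma module_syzygy:
  assumes "module R N"
  shows "module R (syzygy R N)"
proof -
  interpret module R N by fact
  show ?thesis
    unfolding syzygy_def
    by (rule module_kernel[OF module_free_cover assms linear_cover_map[OF assms]]) (rule R.cring_axioms)
qed

lemma syzygy_sel [simp]:
  "x \<in> carrier (syzygy R N) \<longleftrightarrow> x \<in> carrier (free_cover R N) \<and> cover_map R N x = \<zero>\<^bsub>N\<^esub>"
  "\<zero>\<^bsub>syzygy R N\<^esub> = \<zero>\<^bsub>free_cover R N\<^esub>"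
  "x \<oplus>\<^bsub>syzygy R N\<^esub> y = x \<oplus>\<^bsub>free_cover R N\<^esub> y"
  "r \<odot>\<^bsub>syzygy R N\<^esub> x = r \<odot>\<^bsub>free_cover R N\<^esub> x"
  by (simp_all add: syzygy_def a_kernel_def')

lemma linear_cover_syzygy:
  assumes "module R N"
  shows "linear_map R (free_cover R (syzygy R N)) (free_cover R N) (cover_map R (syzygy R N))"
  using linear_mapD[OF linear_cover_map[OF module_syzygy[OF assms]]] by (auto intro!: linear_mapI)

section \<open>The first Ext module\<close>

text \<open>
  A cocycle is a linear map on \<open>P\<^sub>1\<close> that vanishes on the kernel of \<open>P\<^sub>1 \<rightarrow> P\<^sub>0\<close>, because \<open>P\<^sub>2\<close> covers this
  kernel.  As \<open>P\<^sub>1\<close> covers the syzygy module, cocycles are the same as linear maps from the syzygy module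
  to \<open>M\<close>.  The coboundaries correspond to those that are restrictions of linear maps on \<open>P\<^sub>0\<close>.
\<close>

lemma zero_Ext1_iff:
  assumes "module R N" "module R M"
  shows "zero_module (Ext1 R N M) \<longleftrightarrow>
    (\<forall>g. linear_map R (syzygy R N) M g \<longrightarrow>
      (\<exists>h. linear_map R (free_cover R N) M h \<and> (\<forall>x\<in>carrier (syzygy R N). h x = g x)))"
proof -
  interpret M: module R M by fact
  let ?P0 = "free_cover R N" and ?K0 = "syzygy R N"
  let ?P1 = "free_cover R ?K0" and ?K1 = "syzygy R ?K0"
  let ?P2 = "free_cover R ?K1"
  let ?d1 = "cover_map R ?K0" and ?d2 = "cover_map R ?K1"
  note cr = M.R.cring_axioms
  note P0 = module_free_cover[OF cr, of N] and K0 = module_syzygy[OF assms(1)]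
  note P1 = module_free_cover[OF cr, of ?K0] and K1 = module_syzygy[OF K0]
  note P2 = module_free_cover[OF cr, of ?K1]
  note d1 = linear_cover_syzygy[OF assms(1)] and d2 = linear_cover_syzygy[OF K0]
  note D1 = linear_mapD[OF linear_cover_map[OF K0]] and D2 = linear_mapD[OF linear_cover_map[OF K1]]
  let ?\<delta>1 = "Hom_map ?P1 ?d1" and ?\<delta>2 = "Hom_map ?P2 ?d2"
  let ?H0 = "Hom_module R ?P0 M" and ?H1 = "Hom_module R ?P1 M" and ?H2 = "Hom_module R ?P2 M"
  have dd: "?d1 (?d2 x) = \<zero>\<^bsub>?P0\<^esub>" "?d2 x \<in> carrier ?P1" if "x \<in> carrier ?P2" for x
    using D2(1)[OF that] by simp_all
  have cocycle: "c \<in> a_kernel ?H1 ?H2 ?\<delta>2 \<longleftrightarrow>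
      c \<in> carrier ?H1 \<and> (\<forall>p\<in>carrier ?P1. ?d1 p = \<zero>\<^bsub>?K0\<^esub> \<longrightarrow> c p = \<zero>\<^bsub>M\<^esub>)" (is "?l \<longleftrightarrow> ?r") for c
  proof
    assume l: ?l
    then have v: "c (?d2 x) = \<zero>\<^bsub>M\<^esub>" if "x \<in> carrier ?P2" for x
      using that by (auto simp: a_kernel_def' Hom_map_def Hom_module_sel fun_eq_iff restrict_def split: if_splits)
    have "c p = \<zero>\<^bsub>M\<^esub>" if "p \<in> carrier ?P1" "?d1 p = \<zero>\<^bsub>?K0\<^esub>" for p
      using cover_map_surj[OF K1, of p] v that by auto
    then show ?r using l by (simp add: a_kernel_def')
  next
    assume ?r
    then show ?l using dd by (auto simp: a_kernel_def' Hom_map_def Hom_module_sel)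
  qed
  have "zero_module (Ext1 R N M) \<longleftrightarrow> a_kernel ?H1 ?H2 ?\<delta>2 \<subseteq> ?\<delta>1 ` carrier ?H0"
    unfolding Ext1_def Let_def
  proof (rule zero_homology_iff)
    fix f assume "f \<in> carrier ?H0"
    then have "f \<zero>\<^bsub>?P0\<^esub> = \<zero>\<^bsub>M\<^esub>"
      using linear_map_zero[OF P0 assms(2)] by (simp only: Hom_module_sel(1))
    then have "f (?d1 (?d2 x)) = \<zero>\<^bsub>M\<^esub>" if "x \<in> carrier ?P2" for x
      by (simp only: dd(1)[OF that])
    then show "?\<delta>2 (?\<delta>1 f) = \<zero>\<^bsub>?H2\<^esub>"
      unfolding Hom_map_def Hom_module_sel(2) by (intro restrict_ext) (simp add: dd(2))
  qed (fact module_Hom[OF P0 assms(2)] module_Hom[OF P1 assms(2)] module_Hom[OF P2 assms(2)]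
      linear_Hom_map[OF assms(2) d1 P1 P0] linear_Hom_map[OF assms(2) d2 P2 P1])+
  also have "\<dots> \<longleftrightarrow> (\<forall>g. linear_map R ?K0 M g \<longrightarrow>
      (\<exists>h. linear_map R ?P0 M h \<and> (\<forall>x\<in>carrier ?K0. h x = g x)))"
  proof (intro iffI allI impI subsetI)
    fix g assume sub: "a_kernel ?H1 ?H2 ?\<delta>2 \<subseteq> ?\<delta>1 ` carrier ?H0" and g: "linear_map R ?K0 M g"
    note G = linear_mapD[OF g]
    let ?c = "\<lambda>p\<in>carrier ?P1. g (?d1 p)"
    have "?c \<in> carrier ?H1"
      unfolding Hom_module_sel(1)
      by (intro conjI restrict_extensional linear_mapI)
        (simp_all only: restrict_apply' D1 G module.smult_closed[OF P1] module_add_closed[OF P1])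
    then have "?c \<in> a_kernel ?H1 ?H2 ?\<delta>2"
      using linear_map_zero[OF K0 assms(2) g] unfolding cocycle by simp
    then obtain h where h: "h \<in> carrier ?H0" "?c = ?\<delta>1 h" using sub by blast
    have "h x = g x" if x: "x \<in> carrier ?K0" for x
    proof -
      obtain p where p: "p \<in> carrier ?P1" "?d1 p = x" using cover_map_surj[OF K0 x] by blast
      then have "?c p = ?\<delta>1 h p" using h(2) by simp
      then show ?thesis using p by (simp add: Hom_map_def)
    qed
    then show "\<exists>h. linear_map R ?P0 M h \<and> (\<forall>x\<in>carrier ?K0. h x = g x)"
      using h(1) unfolding Hom_module_sel(1) by blast
  next
    fix c assume ext: "\<forall>g. linear_map R ?K0 M g \<longrightarrow>
      (\<exists>h. linear_map R ?P0 M h \<and> (\<forall>x\<in>carrier ?K0. h x = g x))"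
      and "c \<in> a_kernel ?H1 ?H2 ?\<delta>2"
    then have c: "c \<in> extensional (carrier ?P1)" "linear_map R ?P1 M c"
      "\<And>p. p \<in> carrier ?P1 \<Longrightarrow> ?d1 p = \<zero>\<^bsub>?K0\<^esub> \<Longrightarrow> c p = \<zero>\<^bsub>M\<^esub>"
      unfolding cocycle Hom_module_sel(1) by blast+
    obtain g where g: "linear_map R ?K0 M g" "\<forall>p\<in>carrier ?P1. g (?d1 p) = c p"
      using linear_map_factor[OF P1 K0 assms(2) linear_cover_map[OF K0] cover_map_surj[OF K0] c(2,3)] by blast
    obtain h where h: "linear_map R ?P0 M h" "\<forall>x\<in>carrier ?K0. h x = g x"
      using ext g(1) by blast
    have "c = ?\<delta>1 (restrict h (carrier ?P0))"
    proof (rule extensionalityI[OF c(1)])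
      show "?\<delta>1 (restrict h (carrier ?P0)) \<in> extensional (carrier ?P1)" by (simp add: Hom_map_def)
      show "c p = ?\<delta>1 (restrict h (carrier ?P0)) p" if p: "p \<in> carrier ?P1" for p
        using D1(1)[OF p] g(2) h(2) p by (simp add: Hom_map_def)
    qed
    moreover have "restrict h (carrier ?P0) \<in> carrier ?H0"
      unfolding Hom_module_sel(1)
      using linear_mapD[OF h(1)]
      by (intro conjI restrict_extensional linear_mapI)
        (simp_all only: restrict_apply' module.smult_closed[OF P0] module_add_closed[OF P0])
    ultimately show "c \<in> ?\<delta>1 ` carrier ?H0" by blast
  qed
  finally show ?thesis .
qed

lemma residue_module_sel [simp]:
  "carrier (residue_module R \<mm>) = a_rcosets\<^bsub>R\<^esub> \<mm>" "\<zero>\<^bsub>residue_module R \<mm>\<^esub> = \<mm>"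
  by (simp_all add: residue_module_def FactRing_def)

lemma residue_module_linear:
  assumes "cring R" "ideal \<mm> R"
  shows "module R (residue_module R \<mm>)"
    "linear_map R (regular_module R) (residue_module R \<mm>) (\<lambda>r. \<mm> +>\<^bsub>R\<^esub> r)"
proof -
  interpret cring R by fact
  interpret ideal \<mm> R by fact
  note hom = rcos_ring_hom and Q = module_regular[OF quotient_is_cring[OF assms(1)]]
  show "module R (residue_module R \<mm>)"
    unfolding residue_module_def by (rule module_restrict_scalars[OF assms(1) hom Q])
  show "linear_map R (regular_module R) (residue_module R \<mm>) (\<lambda>r. \<mm> +>\<^bsub>R\<^esub> r)"
    unfolding residue_module_def
    by (rule linear_mapI) (simp_all add: ring_hom_closed[OF hom] ring_hom_add[OF hom] ring_hom_mult[OF hom])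
qed

text \<open>
  The group \<open>Ext\<^sup>1(R / \<mm>, M)\<close> can be computed from the exact sequence \<open>\<mm> \<rightarrow> R \<rightarrow> R / \<mm>\<close> as well as from the
  free cover \<open>K\<^sub>0 \<rightarrow> P\<^sub>0 \<rightarrow> R / \<mm>\<close>.  To compare the two, \<open>P\<^sub>0\<close> is mapped to \<open>R\<close> by a lift \<open>s\<close> of the cover map
  along \<open>\<pi> : R \<rightarrow> R / \<mm>\<close>.  Then \<open>s\<close> sends \<open>K\<^sub>0\<close> to \<open>\<mm>\<close>, a linear map on \<open>\<mm>\<close> is pulled back to \<open>K\<^sub>0\<close> and extended
  to \<open>P\<^sub>0\<close>, and the extension is restricted along \<open>R \<rightarrow> P\<^sub>0\<close>, \<open>r \<mapsto> r e\<close>, where \<open>e\<close> is the basis vector of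
  the unit coset.
\<close>

lemma residue_Ext1_zero_extends:
  assumes "cring R" "ideal \<mm> R" "module R M"
    and Ext: "zero_module (Ext1 R (residue_module R \<mm>) M)"
    and G: "linear_graph R (regular_module R) M G" "Domain G = \<mm>"
  shows "\<exists>y\<in>carrier M. \<forall>(r, z)\<in>G. z = r \<odot>\<^bsub>M\<^esub> y"
proof -
  interpret M: module R M by fact
  interpret \<mm>: ideal \<mm> R by fact
  let ?k = "residue_module R \<mm>" and ?\<pi> = "\<lambda>r. \<mm> +>\<^bsub>R\<^esub> r"
  let ?A = "regular_module R"
  note k = residue_module_linear[OF assms(1,2)] and A = module_regular[OF assms(1)]
  note P = module_free_cover[OF assms(1), of ?k] and K = module_syzygy[OF k(1)]
  note D = linear_graphD[OF G(1), simplified]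
  note unique = linear_graph_unique[OF A assms(3) G(1)]
  note k_monoid = abelian_group.axioms(1)[OF module.axioms(2)[OF k(1)]]
  have one: "?\<pi> \<one>\<^bsub>R\<^esub> \<in> carrier ?k" using linear_mapD(1)[OF k(2)] by simp
  have "\<exists>r\<in>carrier R. ?\<pi> r = X" if "X \<in> carrier ?k" for X
    using that unfolding residue_module_sel A_RCOSETS_def' by blast
  then obtain w0 where w0: "\<And>X. X \<in> carrier ?k \<Longrightarrow> w0 X \<in> carrier R"
    "\<And>X. X \<in> carrier ?k \<Longrightarrow> ?\<pi> (w0 X) = X" by metis
  \<comment> \<open>The unit coset is represented by the unit itself, so that \<open>s\<close> maps the basis vector \<open>e\<close> to it.\<close>
  define w where "w = w0(?\<pi> \<one>\<^bsub>R\<^esub> := \<one>\<^bsub>R\<^esub>)"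
  have w: "w \<in> carrier ?k \<rightarrow> carrier ?A" "\<And>X. X \<in> carrier ?k \<Longrightarrow> ?\<pi> (w X) = X" "w (?\<pi> \<one>\<^bsub>R\<^esub>) = \<one>\<^bsub>R\<^esub>"
    using w0 by (auto simp: w_def)
  define s where "s = free_lift R ?A (carrier ?k) w"
  have s: "linear_map R (free_cover R ?k) ?A s"
    unfolding s_def free_cover_def by (rule linear_free_lift[OF A w(1)])
  note S = linear_mapD[OF s]
  have \<pi>s: "?\<pi> (s p) = cover_map R ?k p" if "p \<in> carrier (free_cover R ?k)" for p
  proof -
    have "?\<pi> (s p) = free_lift R ?k (carrier ?k) (\<lambda>X. ?\<pi> (w X)) p"
      unfolding s_def by (rule linear_map_free_lift[OF A k w(1)]) (use that in \<open>simp add: free_cover_def\<close>)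
    also have "\<dots> = cover_map R ?k p"
      unfolding cover_map_eq_free_lift free_lift_def
      by (rule abelian_monoid.finsum_cong'[OF k_monoid])
        (use w(2) module.smult_closed[OF k(1)] free_moduleD(1)[OF that[unfolded free_cover_def]] in auto)
    finally show ?thesis .
  qed
  have \<pi>0: "?\<pi> r = \<mm> \<longleftrightarrow> r \<in> \<mm>" if "r \<in> carrier R" for r
    using that M.R.a_coset_join1[OF _ that \<mm>.a_subgroup] M.R.a_coset_join2[OF that \<mm>.a_subgroup] by blast
  have sK: "s p \<in> \<mm>" if "p \<in> carrier (syzygy R ?k)" for p
    using \<pi>s[of p] \<pi>0[of "s p"] S(1)[of p] that by simp
  then have "\<exists>z. (s p, z) \<in> G" if "p \<in> carrier (syzygy R ?k)" for p using G(2) that by blast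
  then obtain g where g: "\<And>p. p \<in> carrier (syzygy R ?k) \<Longrightarrow> (s p, g p) \<in> G" by metis
  have "linear_map R (syzygy R ?k) M g"
  proof (rule linear_mapI)
    show "g p \<in> carrier M" if "p \<in> carrier (syzygy R ?k)" for p using D(2)[OF g[OF that]] .
    show "g (p \<oplus>\<^bsub>syzygy R ?k\<^esub> q) = g p \<oplus>\<^bsub>M\<^esub> g q"
      if "p \<in> carrier (syzygy R ?k)" "q \<in> carrier (syzygy R ?k)" for p q
    proof (rule unique)
      show "(s p \<oplus>\<^bsub>R\<^esub> s q, g p \<oplus>\<^bsub>M\<^esub> g q) \<in> G" using D(4) g that by blast
      have "p \<oplus>\<^bsub>syzygy R ?k\<^esub> q \<in> carrier (syzygy R ?k)"
        by (rule module_add_closed[OF K that])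
      from g[OF this] show "(s p \<oplus>\<^bsub>R\<^esub> s q, g (p \<oplus>\<^bsub>syzygy R ?k\<^esub> q)) \<in> G" using S(2) that by simp
    qed
    show "g (r \<odot>\<^bsub>syzygy R ?k\<^esub> p) = r \<odot>\<^bsub>M\<^esub> g p"
      if "r \<in> carrier R" "p \<in> carrier (syzygy R ?k)" for r p
    proof (rule unique)
      show "(r \<otimes>\<^bsub>R\<^esub> s p, r \<odot>\<^bsub>M\<^esub> g p) \<in> G" using D(5) g that by blast
      have "r \<odot>\<^bsub>syzygy R ?k\<^esub> p \<in> carrier (syzygy R ?k)" by (rule module.smult_closed[OF K that])
      from g[OF this] show "(r \<otimes>\<^bsub>R\<^esub> s p, g (r \<odot>\<^bsub>syzygy R ?k\<^esub> p)) \<in> G" using S(3) that by simp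
    qed
  qed
  then obtain h where h: "linear_map R (free_cover R ?k) M h" "\<And>p. p \<in> carrier (syzygy R ?k) \<Longrightarrow> h p = g p"
    using Ext unfolding zero_Ext1_iff[OF k(1) assms(3)] by blast
  let ?e = "basis_vector R (?\<pi> \<one>\<^bsub>R\<^esub>)"
  have e: "?e \<in> carrier (free_cover R ?k)"
    unfolding free_cover_def by (rule basis_vector_closed[OF assms(1) one])
  have se: "s ?e = \<one>\<^bsub>R\<^esub>"
    unfolding s_def using free_lift_basis_vector[OF A w(1) one] w(3) by simp
  have "z = r \<odot>\<^bsub>M\<^esub> h ?e" if rz: "(r, z) \<in> G" for r z
  proof -
    have r: "r \<in> carrier R" "r \<in> \<mm>" using D(1)[OF rz] rz G(2) by auto
    let ?p = "r \<odot>\<^bsub>free_cover R ?k\<^esub> ?e"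
    have p: "?p \<in> carrier (free_cover R ?k)" by (rule module.smult_closed[OF P r(1) e])
    have sp: "s ?p = r" using S(3)[OF r(1) e] se r by simp
    then have pK: "?p \<in> carrier (syzygy R ?k)" using \<pi>s[OF p] \<pi>0[OF r(1)] r p by simp
    have "g ?p = z" using unique[OF _ rz] g[OF pK] sp by simp
    then show ?thesis using h(2)[OF pK] linear_mapD(3)[OF h(1) r(1) e] by simp
  qed
  then show ?thesis using linear_mapD(1)[OF h(1) e] by blast
qed

text \<open>
  Conversely to the passage from \<open>\<mm>\<close> to all ideals, a module that satisfies Baer's condition admits
  extensions along the inclusion of the syzygy module of \<open>R / \<mm>\<close> in its free cover, which is what the
  vanishing of \<open>Ext\<^sup>1\<close> requires.
\<close>

theorem residue_Ext1_zero_iff_baer: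
  assumes "noetherian_local_ring R \<mm>" "module R M"
    and "\<And>a x. a \<in> \<mm> \<Longrightarrow> x \<in> carrier M \<Longrightarrow> \<exists>n::nat. (a [^]\<^bsub>R\<^esub> n) \<odot>\<^bsub>M\<^esub> x = \<zero>\<^bsub>M\<^esub>"
  shows "zero_module (Ext1 R (residue_module R \<mm>) M) \<longleftrightarrow> baer_condition R M"
proof
  have R: "cring R" "maximalideal \<mm> R"
    using assms(1) by (simp_all add: noetherian_local_ring_def local_ring_def)
  note I = maximalideal.axioms(1)[OF R(2)]
  note k = residue_module_linear(1)[OF R(1) I]
  show "baer_condition R M" if "zero_module (Ext1 R (residue_module R \<mm>) M)"
    by (rule baer_of_maximal_ideal[OF assms(1,2) residue_Ext1_zero_extends[OF R(1) I assms(2) that] assms(3)])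
  assume baer: "baer_condition R M"
  show "zero_module (Ext1 R (residue_module R \<mm>) M)"
    unfolding zero_Ext1_iff[OF k assms(2)]
  proof (intro allI impI)
    fix g assume g: "linear_map R (syzygy R (residue_module R \<mm>)) M g"
    have "linear_map R (syzygy R (residue_module R \<mm>)) (free_cover R (residue_module R \<mm>)) (\<lambda>x. x)"
      by (rule linear_mapI) simp_all
    from baer_criterion[OF module_syzygy[OF k] module_free_cover[OF R(1)] assms(2) baer this _ g]
    show "\<exists>h. linear_map R (free_cover R (residue_module R \<mm>)) M h \<and>
        (\<forall>x\<in>carrier (syzygy R (residue_module R \<mm>)). h x = g x)" by simp
  qed
qed

section \<open>Injectivity of Artinian modules along a local homomorphism\<close>

theorem theorem6p1:
  fixes R :: "('r, 'x) ring_scheme" and S :: "('s, 'y) ring_scheme"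
    and M :: "('s, 'm, 'z) module_scheme" and \<phi> :: "'r \<Rightarrow> 's"
    and \<mm> :: "'r set" and \<nn> :: "'s set"
  assumes "noetherian_local_ring R \<mm>"
    and "noetherian_local_ring S \<nn>"
    and "local_hom R \<mm> S \<nn> \<phi>"
    and "artinian_module S M"
  shows "injective_module TYPE('r + 'u) R (restrict_scalars \<phi> M) \<longleftrightarrow>
         zero_module (Ext1 R (residue_module R \<mm>) (restrict_scalars \<phi> M))"
proof -
  have R: "cring R" "maximalideal \<mm> R" and S: "cring S"
    using assms(1,2) by (simp_all add: noetherian_local_ring_def local_ring_def)
  have \<phi>: "\<phi> \<in> ring_hom R S" "\<phi> ` \<mm> \<subseteq> \<nn>" using assms(3) by (simp_all add: local_hom_def)
  interpret \<phi>: ring_hom_cring R S \<phi>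
    by (intro ring_hom_cring.intro ring_hom_cring_axioms.intro R(1) S \<phi>(1))
  have pow: "\<phi> (a [^]\<^bsub>R\<^esub> n) = \<phi> a [^]\<^bsub>S\<^esub> n" if "a \<in> carrier R" for a and n :: nat
    by (induction n) (use that in simp_all)
  have M: "module R (restrict_scalars \<phi> M)"
    by (rule module_restrict_scalars[OF R(1) \<phi>(1)]) (use assms(4) in \<open>simp add: artinian_module_def\<close>)
  have torsion: "\<exists>n::nat. (a [^]\<^bsub>R\<^esub> n) \<odot>\<^bsub>restrict_scalars \<phi> M\<^esub> x = \<zero>\<^bsub>restrict_scalars \<phi> M\<^esub>"
    if "a \<in> \<mm>" "x \<in> carrier (restrict_scalars \<phi> M)" for a x
  proof -
    have "a \<in> carrier R" using that R(2) by (meson ideal.Icarr maximalideal.axioms(1))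
    then show ?thesis
      using artinian_torsion[OF assms(2,4), of "\<phi> a" x] that \<phi>(2) by (auto simp: pow)
  qed
  show ?thesis
    using injective_iff_baer[OF M] residue_Ext1_zero_iff_baer[OF assms(1) M torsion] by blast
qed

end
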